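(* Let $G$ be a countable irreducible weighted graph with weighted adjacency matrix $A$ satisfying $\sup_{x\in G}\sum_{y\in G}A(x,y)<\infty$, let $\mathcal T$ be a subgroup of $\mathrm{Aut}(G)$, and let $\rho$ and $\overline\rho$ be the combinatorial spectral radii of $G$ and of the reduced graph $\overline G$ (the orbit space of $\mathcal T$). Then $\rho=\overline\rho$ if any of the following conditions is met: (i) There exists $x\in G$ whose orbit $\overline x$ is finite. (ii) $G$ is locally finite, $A$ is symmetric, and there exist $x_0,x\in G$ such that $$\lim_{n\to\infty}\frac{\ln\left(|B(x_0,n)\cap\overline x|\right)}{n}=0.$$ (iii) There exists a positive $\mathcal T$-invariant function $\psi$ on $G$ such that $A\psi\le\rho\,\psi$. (iv) $G$ is symmetric, locally finite and unweighted, $\mathcal T$ is quasi-transitive, and either (a) $G$ does not satisfy a strong isoperimetric inequality, i.e. $\inf_{L}\frac{|\partial L|}{|L|}=0$, the infimum being over finite nonempty $L\subset G$; or (b) $\mathcal T$ is amenable and unimodular.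
   Context: $G$ also denotes the vertex set; $A:G\times G\to[0,\infty)$, and $(x,y)$ is an edge iff $A(x,y)>0$. Irreducible: for all $x,y$ there is $n$ with $A^n(x,y)>0$. Unweighted: $A$ has entries in $\{0,1\}$; symmetric: $A(x,y)=A(y,x)$; locally finite: every vertex has finitely many neighbors. The combinatorial spectral radius of an irreducible weighted graph is the inverse of the radius of convergence of $\sum_{n\ge0}A^n(x,y)z^n$, which does not depend on $x,y$. $\mathrm{Aut}(G)$ is the group of permutations $\tau$ of $G$ with $A(\tau x,\tau y)=A(x,y)$ for all $x,y$. The orbit of $x$ under $\mathcal T$ is $\overline x$ and the orbit space is $\overline G$. The reduced graph is $\overline G$ with weighted adjacency matrix $\overline A(\overline x,\overline y)=\sum_{y'\in\overline y}A(x,y')$, for any choice of $x\in\overline x$ (well defined); it is irreducible. $\mathcal T$ is quasi-transitive when $\overline G$ is finite. A function $\psi$ on $G$ is $\mathcal T$-invariant if $\psi(\tau x)=\psi(x)$ for all $\tau\in\mathcal T$, $x\in G$. For graph automorphisms and amenable groups, the terminology is that of W. Woess, Random Walks on Infinite Graphs and Groups (2000). $B(x_0,n)=\{x\in G:\exists\,0\le k\le n,\ A^k(x_0,x)>0\}$. For $L\subset G$, $\partial L$ is the set of $y\in G\setminus L$ such that $(x,y)$ is an edge for some $x\in L$. $|\cdot|$ denotes cardinality. *)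

theory Defs
  imports "HOL-Analysis.Analysis" "HOL-Algebra.Group_Action"
begin

section \<open>Weighted graphs\<close>

text \<open>
  A weighted graph is a nonempty vertex set \<open>V\<close> with a matrix \<open>A\<close> of which only the entries
  indexed by \<open>V\<close> matter. The vertex set is explicit because the reduced graph lives on a set of
  subsets of \<open>V\<close>.
\<close>

definition weighted_graph :: "'a set \<Rightarrow> ('a \<Rightarrow> 'a \<Rightarrow> real) \<Rightarrow> bool" where
  "weighted_graph V A \<longleftrightarrow> V \<noteq> {} \<and> (\<forall>x\<in>V. \<forall>y\<in>V. 0 \<le> A x y)"

text \<open>
  The sums below converge whenever the row sums of \<open>A\<close> are bounded: if \<open>C\<close> is a bound,
  the entries of the \<open>n\<close>-th power are at most \<open>C ^ n\<close>.
\<close>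

fun mat_power :: "'a set \<Rightarrow> ('a \<Rightarrow> 'a \<Rightarrow> real) \<Rightarrow> nat \<Rightarrow> 'a \<Rightarrow> 'a \<Rightarrow> real" where
  "mat_power V A 0 x y = (if x = y then 1 else 0)"
| "mat_power V A (Suc n) x y = (\<Sum>\<^sub>\<infinity>z\<in>V. A x z * mat_power V A n z y)"

definition bounded_row_sums :: "'a set \<Rightarrow> ('a \<Rightarrow> 'a \<Rightarrow> real) \<Rightarrow> bool" where
  "bounded_row_sums V A \<longleftrightarrow> (SUP x\<in>V. \<Sum>\<^sub>\<infinity>y\<in>V. ennreal (A x y)) < \<infinity>"

definition irreducible_graph :: "'a set \<Rightarrow> ('a \<Rightarrow> 'a \<Rightarrow> real) \<Rightarrow> bool" where
  "irreducible_graph V A \<longleftrightarrow> (\<forall>x\<in>V. \<forall>y\<in>V. \<exists>n. mat_power V A n x y > 0)"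

definition symmetric_graph :: "'a set \<Rightarrow> ('a \<Rightarrow> 'a \<Rightarrow> real) \<Rightarrow> bool" where
  "symmetric_graph V A \<longleftrightarrow> (\<forall>x\<in>V. \<forall>y\<in>V. A x y = A y x)"

definition unweighted_graph :: "'a set \<Rightarrow> ('a \<Rightarrow> 'a \<Rightarrow> real) \<Rightarrow> bool" where
  "unweighted_graph V A \<longleftrightarrow> (\<forall>x\<in>V. \<forall>y\<in>V. A x y \<in> {0, 1})"

definition locally_finite_graph :: "'a set \<Rightarrow> ('a \<Rightarrow> 'a \<Rightarrow> real) \<Rightarrow> bool" where
  "locally_finite_graph V A \<longleftrightarrow> (\<forall>x\<in>V. finite {y\<in>V. A x y > 0})"

definition graph_ball :: "'a set \<Rightarrow> ('a \<Rightarrow> 'a \<Rightarrow> real) \<Rightarrow> 'a \<Rightarrow> nat \<Rightarrow> 'a set" where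
  "graph_ball V A x0 n = {x\<in>V. \<exists>k\<le>n. mat_power V A k x0 x > 0}"

definition outer_boundary :: "'a set \<Rightarrow> ('a \<Rightarrow> 'a \<Rightarrow> real) \<Rightarrow> 'a set \<Rightarrow> 'a set" where
  "outer_boundary V A L = {y\<in>V - L. \<exists>x\<in>L. A x y > 0}"

text \<open>
  In an irreducible graph the radius of convergence is the same for all pairs of vertices; the
  description operator picks this common value. The conventions \<open>inverse \<infinity> = 0\<close> and
  \<open>inverse 0 = \<infinity>\<close> of \<^typ>\<open>ereal\<close> are the intended ones.
\<close>

definition spectral_radius :: "'a set \<Rightarrow> ('a \<Rightarrow> 'a \<Rightarrow> real) \<Rightarrow> ereal" where
  "spectral_radius V A =
     (THE r. \<forall>x\<in>V. \<forall>y\<in>V. r = inverse (conv_radius (\<lambda>n. mat_power V A n x y)))"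


section \<open>Automorphisms and the reduced graph\<close>

definition aut_group :: "'a set \<Rightarrow> ('a \<Rightarrow> 'a \<Rightarrow> real) \<Rightarrow> ('a \<Rightarrow> 'a) monoid" where
  "aut_group V A =
     (BijGroup V)\<lparr>carrier := {\<tau> \<in> Bij V. \<forall>x\<in>V. \<forall>y\<in>V. A (\<tau> x) (\<tau> y) = A x y}\<rparr>"

abbreviation acting_group ::
    "'a set \<Rightarrow> ('a \<Rightarrow> 'a \<Rightarrow> real) \<Rightarrow> ('a \<Rightarrow> 'a) set \<Rightarrow> ('a \<Rightarrow> 'a) monoid" where
  "acting_group V A T \<equiv> (aut_group V A)\<lparr>carrier := T\<rparr>"

abbreviation vertex_orbit ::
    "'a set \<Rightarrow> ('a \<Rightarrow> 'a \<Rightarrow> real) \<Rightarrow> ('a \<Rightarrow> 'a) set \<Rightarrow> 'a \<Rightarrow> 'a set" where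
  "vertex_orbit V A T x \<equiv> orbit (acting_group V A T) (\<lambda>\<tau>. \<tau>) x"

abbreviation orbit_space ::
    "'a set \<Rightarrow> ('a \<Rightarrow> 'a \<Rightarrow> real) \<Rightarrow> ('a \<Rightarrow> 'a) set \<Rightarrow> 'a set set" where
  "orbit_space V A T \<equiv> orbits (acting_group V A T) V (\<lambda>\<tau>. \<tau>)"

text \<open>The sum does not depend on the representative \<open>x\<close> when \<open>X\<close> and \<open>Y\<close> are orbits.\<close>

definition reduced_matrix :: "('a \<Rightarrow> 'a \<Rightarrow> real) \<Rightarrow> 'a set \<Rightarrow> 'a set \<Rightarrow> real" where
  "reduced_matrix A X Y = (THE s. \<forall>x\<in>X. s = (\<Sum>\<^sub>\<infinity>y\<in>Y. A x y))"

definition quasi_transitive ::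
    "'a set \<Rightarrow> ('a \<Rightarrow> 'a \<Rightarrow> real) \<Rightarrow> ('a \<Rightarrow> 'a) set \<Rightarrow> bool" where
  "quasi_transitive V A T \<longleftrightarrow> finite (orbit_space V A T)"

text \<open>Topology of pointwise convergence on \<open>T\<close>, the vertex set being discrete.\<close>

definition pointwise_topology :: "'a set \<Rightarrow> ('a \<Rightarrow> 'a) set \<Rightarrow> ('a \<Rightarrow> 'a) topology" where
  "pointwise_topology V T = subtopology (product_topology (\<lambda>_. discrete_topology V) V) T"


section \<open>Amenable and unimodular groups\<close>

text \<open>
  Here \<open>G\<close> is a group and \<open>X\<close> a Hausdorff group topology on its carrier. Amenability and
  unimodularity are notions about locally compact groups; \<open>haar_measure\<close> therefore
  includes local compactness of \<open>X\<close>. For a subgroup of the automorphism group of a connected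
  locally finite graph, this says that the subgroup is closed.
\<close>

definition haar_measure :: "('g, 'b) monoid_scheme \<Rightarrow> 'g topology \<Rightarrow> 'g measure \<Rightarrow> bool" where
  "haar_measure G X \<mu> \<longleftrightarrow>
     locally_compact_space X \<and>
     sets \<mu> = sets (sigma (topspace X) {U. openin X U}) \<and>
     (\<forall>K. compactin X K \<longrightarrow> emeasure \<mu> K < \<infinity>) \<and>
     (\<forall>B\<in>sets \<mu>. emeasure \<mu> B = (INF U\<in>{U. openin X U \<and> B \<subseteq> U}. emeasure \<mu> U)) \<and>
     (\<forall>U. openin X U \<longrightarrow>
        emeasure \<mu> U = (SUP K\<in>{K. compactin X K \<and> K \<subseteq> U}. emeasure \<mu> K)) \<and>
     (\<forall>U. openin X U \<and> U \<noteq> {} \<longrightarrow> 0 < emeasure \<mu> U) \<and>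
     (\<forall>g\<in>carrier G. \<forall>B\<in>sets \<mu>. emeasure \<mu> ((\<lambda>h. g \<otimes>\<^bsub>G\<^esub> h) ` B) = emeasure \<mu> B)"

text \<open>
  Haar measures exist and are unique up to a positive factor on a locally compact group, so the
  existential quantifiers below could equally be universal ones.
\<close>

definition unimodular_group :: "('g, 'b) monoid_scheme \<Rightarrow> 'g topology \<Rightarrow> bool" where
  "unimodular_group G X \<longleftrightarrow>
     (\<exists>\<mu>. haar_measure G X \<mu> \<and>
        (\<forall>g\<in>carrier G. \<forall>B\<in>sets \<mu>. emeasure \<mu> ((\<lambda>h. h \<otimes>\<^bsub>G\<^esub> g) ` B) = emeasure \<mu> B))"

definition ess_bounded :: "'g measure \<Rightarrow> ('g \<Rightarrow> real) set" where
  "ess_bounded \<mu> = {f \<in> borel_measurable \<mu>. \<exists>C. AE h in \<mu>. \<bar>f h\<bar> \<le> C}"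

text \<open>
  A left invariant mean on \<open>L\<^sup>\<infinity>\<close>. Positivity and linearity make \<open>m f\<close> depend only on the
  almost-everywhere class of \<open>f\<close>.
\<close>

definition left_invariant_mean ::
    "('g, 'b) monoid_scheme \<Rightarrow> 'g measure \<Rightarrow> (('g \<Rightarrow> real) \<Rightarrow> real) \<Rightarrow> bool" where
  "left_invariant_mean G \<mu> m \<longleftrightarrow>
     m (\<lambda>_. 1) = 1 \<and>
     (\<forall>f\<in>ess_bounded \<mu>. (AE h in \<mu>. 0 \<le> f h) \<longrightarrow> 0 \<le> m f) \<and>
     (\<forall>f\<in>ess_bounded \<mu>. \<forall>f'\<in>ess_bounded \<mu>. m (\<lambda>h. f h + f' h) = m f + m f') \<and>
     (\<forall>c. \<forall>f\<in>ess_bounded \<mu>. m (\<lambda>h. c * f h) = c * m f) \<and>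
     (\<forall>g\<in>carrier G. \<forall>f\<in>ess_bounded \<mu>. m (\<lambda>h. f (g \<otimes>\<^bsub>G\<^esub> h)) = m f)"

definition amenable_group :: "('g, 'b) monoid_scheme \<Rightarrow> 'g topology \<Rightarrow> bool" where
  "amenable_group G X \<longleftrightarrow> (\<exists>\<mu> m. haar_measure G X \<mu> \<and> left_invariant_mean G \<mu> m)"

end

(*
  Since A^n(x,y) is at most the corresponding entry of the reduced graph, only "<=" for the reduced
  spectral radius needs proof, and an entry of the n-th power of the reduced matrix is the sum of
  A^n(x,y) over y in an orbit. For (i) and (ii) one bounds this sum by the number of its terms; in
  (ii) symmetry gives A^n(x,y)^2 <= A^(2n)(x,x). In (iii) psi descends to the reduced graph and
  forces exponential growth rate at most rho there.

  For (iv) suppose rho < k < s < reduced rho. The Green function at 1/k is a positive g with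
  A g <= k g, and the finite reduced graph carries a positive h with s h <= A h, which lifts to a
  T-invariant function. By AM-GM the quadratic form of A is at most k, while on h 1_L it is at
  least s up to a multiple of |boundary of L| / |L|; this settles (a). For (b), averaging
  ln g(tau^-1 y) - ln g(tau^-1 x) over T by the invariant mean gives an antisymmetric T-invariant
  beta(x,y), and by Jensen the T-invariant antisymmetric function
  A(x,y) h(x) h(y) (ln h(x) - ln h(y) + beta(x,y)) has negative sum over y for every x. By
  unimodularity the mass transport principle, with orbits weighted by the inverse Haar measure of
  the stabilizers, says that these sums cancel.
*)
theory Submission
  imports Defs
begin

text \<open>The obstacle in (iv) is that the Green function \<open>g\<close> is not known to be
  invariant under \<open>T\<close>, so it cannot be passed to the reduced graph. In (a) it serves
  only as the weight of a Schur test, where invariance does not matter. In (b) what can be averaged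
  are the increments of ln \<open>g\<close> along an edge: every edge can be traversed both ways, so
  A g <= k g bounds them in absolute value by ln (k / A(x,y)), and this bound is the same for all
  translates of the edge. No such bound is available for \<open>g\<close> itself. Passing to
  logarithms is harmless because concavity points in the right direction, and the gap between
  \<open>k\<close> and \<open>s\<close> enters as ln (k / s) < 0, which makes the sums strictly
  negative. Orbits and stabilizers may both be infinite, so masses are compared by Haar measure
  instead of counting: a vertex stabilizer is open, hence of positive measure, and local compactness
  together with local finiteness makes that measure finite.\<close>

section \<open>Preliminaries on sums and power series\<close>

text \<open>Tonelli in the reals. A divergent real \<open>infsum\<close> is 0, so an exchange of
  sums is of use only together with summability of the slices and of the slice sums. Nonnegativity
  turns iterated summability into summability on the product, from which all three follow.\<close>

lemma nonneg_infsum_swap: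
  fixes f :: "'a \<Rightarrow> 'b \<Rightarrow> real"
  assumes nonneg: "\<And>x y. x \<in> A \<Longrightarrow> y \<in> B \<Longrightarrow> 0 \<le> f x y"
    and inner: "\<And>x. x \<in> A \<Longrightarrow> f x summable_on B"
    and outer: "(\<lambda>x. \<Sum>\<^sub>\<infinity>y\<in>B. f x y) summable_on A"
  shows "\<And>y. y \<in> B \<Longrightarrow> (\<lambda>x. f x y) summable_on A"
    and "(\<lambda>y. \<Sum>\<^sub>\<infinity>x\<in>A. f x y) summable_on B"
    and "(\<Sum>\<^sub>\<infinity>y\<in>B. \<Sum>\<^sub>\<infinity>x\<in>A. f x y) = (\<Sum>\<^sub>\<infinity>x\<in>A. \<Sum>\<^sub>\<infinity>y\<in>B. f x y)"
proof -
  have sum: "(\<lambda>(x, y). f x y) summable_on A \<times> B"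
    by (rule summable_on_SigmaI[OF _ outer]) (use nonneg inner in auto)
  then have sum': "(\<lambda>(y, x). f x y) summable_on B \<times> A"
    by (subst (asm) summable_on_swap) (simp add: case_prod_unfold)
  show slice: "(\<lambda>x. f x y) summable_on A" if "y \<in> B" for y
    using summable_on_SigmaD1[OF sum' that] .
  show "(\<lambda>y. \<Sum>\<^sub>\<infinity>x\<in>A. f x y) summable_on B"
    using summable_on_SigmaD[OF sum'] slice by simp
  show "(\<Sum>\<^sub>\<infinity>y\<in>B. \<Sum>\<^sub>\<infinity>x\<in>A. f x y) = (\<Sum>\<^sub>\<infinity>x\<in>A. \<Sum>\<^sub>\<infinity>y\<in>B. f x y)"
    by (rule infsum_swap_banach[OF sum, symmetric])
qed

text \<open>Together with \<open>power_bound_obtain\<close> this describes the inverse radius as the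
  infimum of the exponential growth rates of the coefficients, the only form in which radii are
  handled below.\<close>

lemma inverse_conv_radius_le:
  fixes f :: "nat \<Rightarrow> real"
  assumes "0 < k" and bound: "\<And>n. \<bar>f n\<bar> \<le> K * k ^ n"
  shows "inverse (conv_radius f) \<le> ereal k"
proof -
  have "ereal (1 / k) \<le> conv_radius f"
  proof (rule conv_radius_geI_ex')
    fix r assume r: "0 < r" "ereal r < ereal (1 / k)"
    then have "\<bar>k * r\<bar> < 1"
      using \<open>0 < k\<close> by (simp add: field_simps)
    then have "summable (\<lambda>n. K * (k * r) ^ n)"
      by (intro summable_mult summable_geometric) simp
    then show "summable (\<lambda>n. f n * of_real r ^ n)"
    proof (rule summable_comparison_test'[where N = 0])
      fix n
      have "\<bar>f n\<bar> * r ^ n \<le> K * k ^ n * r ^ n"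
        using bound r by (intro mult_right_mono) auto
      then show "norm (f n * of_real r ^ n) \<le> K * (k * r) ^ n"
        using r by (simp add: abs_mult power_mult_distrib mult.assoc)
    qed
  qed
  then have "inverse (conv_radius f) \<le> inverse (ereal (1 / k))"
    using \<open>0 < k\<close> by (intro ereal_inverse_antimono) auto
  then show ?thesis
    using \<open>0 < k\<close> by simp
qed

lemma inverse_conv_radius_nonneg: "0 \<le> inverse (conv_radius f)"
  using conv_radius_nonneg[of f] by (cases "conv_radius f") auto

lemma summable_divide_power:
  fixes f :: "nat \<Rightarrow> real"
  assumes "inverse (conv_radius f) < ereal k"
  shows "summable (\<lambda>n. f n / k ^ n)"
proof -
  have k: "0 < k"
    using assms inverse_conv_radius_nonneg[of f] by (metis ereal_less(2) le_less_trans)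
  have "ereal (norm (1 / k)) < conv_radius f"
    using assms k conv_radius_nonneg[of f]
    by (cases "conv_radius f") (auto simp: field_simps split: if_splits)
  from summable_in_conv_radius[OF this] show ?thesis
    by (simp add: power_divide)
qed

lemma power_bound_obtain:
  fixes f :: "nat \<Rightarrow> real"
  assumes "inverse (conv_radius f) < ereal k"
  obtains K where "0 < K" "\<And>n. \<bar>f n\<bar> \<le> K * k ^ n"
proof -
  have k: "0 < k"
    using assms inverse_conv_radius_nonneg[of f] by (metis ereal_less(2) le_less_trans)
  have "(\<lambda>n. f n / k ^ n) \<longlonglongrightarrow> 0"
    by (intro summable_LIMSEQ_zero summable_divide_power assms)
  then have "Bseq (\<lambda>n. f n / k ^ n)"
    by (intro convergent_imp_Bseq convergentI)
  then obtain K where "0 < K" "\<And>n. norm (f n / k ^ n) \<le> K"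
    by (auto simp: Bseq_def)
  then show thesis
    using k by (intro that[of K]) (auto simp: field_simps abs_divide)
qed

section \<open>Powers of the adjacency matrix\<close>

text \<open>No group occurs here, so that the results apply to \<open>V\<close> and, through the
  sublocale \<open>red\<close>, to the orbit space as well. Summability is demanded next to the
  bound because a divergent real \<open>infsum\<close> is 0.\<close>

locale bounded_graph =
  fixes V :: "'a set" and A :: "'a \<Rightarrow> 'a \<Rightarrow> real"
  assumes weighted: "weighted_graph V A"
    and rows: "\<exists>C. \<forall>x\<in>V. A x summable_on V \<and> (\<Sum>\<^sub>\<infinity>y\<in>V. A x y) \<le> C"
begin

abbreviation a :: "nat \<Rightarrow> 'a \<Rightarrow> 'a \<Rightarrow> real" where
  "a \<equiv> mat_power V A"

lemma nonempty: "V \<noteq> {}"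
  and nonneg: "x \<in> V \<Longrightarrow> y \<in> V \<Longrightarrow> 0 \<le> A x y"
  using weighted by (auto simp: weighted_graph_def)

lemma row_summable: "x \<in> V \<Longrightarrow> A x summable_on V"
  using rows by blast

lemma power_nonneg: "x \<in> V \<Longrightarrow> y \<in> V \<Longrightarrow> 0 \<le> a n x y"
  by (induction n arbitrary: x) (auto intro!: infsum_nonneg mult_nonneg_nonneg nonneg)

text \<open>The inequality A psi <= k psi iterates, each step exchanging two nonnegative sums. With
  the constant 1 and the rate \<open>C\<close> it bounds the rows of all powers, which makes the
  sums in \<open>mat_power\<close> converge; on the reduced graph it yields (iii).\<close>

lemma superharmonic_power:
  assumes pos: "\<And>x. x \<in> V \<Longrightarrow> 0 < \<psi> x" and k: "0 \<le> k"
    and sum: "\<And>x. x \<in> V \<Longrightarrow> (\<lambda>y. A x y * \<psi> y) summable_on V"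
    and le: "\<And>x. x \<in> V \<Longrightarrow> (\<Sum>\<^sub>\<infinity>y\<in>V. A x y * \<psi> y) \<le> k * \<psi> x"
    and x: "x \<in> V"
  shows "(\<lambda>y. a n x y * \<psi> y) summable_on V \<and> (\<Sum>\<^sub>\<infinity>y\<in>V. a n x y * \<psi> y) \<le> k ^ n * \<psi> x"
  using x
proof (induction n arbitrary: x)
  case 0
  have "((\<lambda>y. a 0 x y * \<psi> y) has_sum \<psi> x) V"
    by (rule has_sum_finite_neutralI[where B = "{x}"]) (use 0 in auto)
  then show ?case
    by (auto simp: infsumI has_sum_imp_summable)
next
  case (Suc n)
  define f where "f z y = A x z * (a n z y * \<psi> y)" for z y
  have f_nonneg: "0 \<le> f z y" if "z \<in> V" "y \<in> V" for z y
    unfolding f_def using that Suc.prems pos[of y]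
    by (intro mult_nonneg_nonneg nonneg power_nonneg) auto
  have inner: "f z summable_on V" if "z \<in> V" for z
    unfolding f_def using Suc.IH[OF that] by (intro summable_on_cmult_right) auto
  have inner_le: "(\<Sum>\<^sub>\<infinity>y\<in>V. f z y) \<le> k ^ n * (A x z * \<psi> z)" if "z \<in> V" for z
  proof -
    have "(\<Sum>\<^sub>\<infinity>y\<in>V. f z y) = A x z * (\<Sum>\<^sub>\<infinity>y\<in>V. a n z y * \<psi> y)"
      unfolding f_def by (rule infsum_cmult_right')
    also have "\<dots> \<le> A x z * (k ^ n * \<psi> z)"
      using Suc.IH[OF that] nonneg[OF Suc.prems that] by (intro mult_left_mono) auto
    finally show ?thesis
      by (simp add: ac_simps)
  qed
  have dom: "(\<lambda>z. k ^ n * (A x z * \<psi> z)) summable_on V"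
    using sum Suc.prems by (intro summable_on_cmult_right) auto
  have outer: "(\<lambda>z. \<Sum>\<^sub>\<infinity>y\<in>V. f z y) summable_on V"
    by (rule summable_on_comparison_test[OF dom]) (use inner_le f_nonneg in \<open>auto intro: infsum_nonneg\<close>)
  have eq: "a (Suc n) x y * \<psi> y = (\<Sum>\<^sub>\<infinity>z\<in>V. f z y)" for y
    by (simp add: f_def infsum_cmult_left' flip: mult.assoc)
  have "(\<Sum>\<^sub>\<infinity>y\<in>V. \<Sum>\<^sub>\<infinity>z\<in>V. f z y) = (\<Sum>\<^sub>\<infinity>z\<in>V. \<Sum>\<^sub>\<infinity>y\<in>V. f z y)"
    by (rule nonneg_infsum_swap(3)[OF f_nonneg inner outer])
  also have "\<dots> \<le> (\<Sum>\<^sub>\<infinity>z\<in>V. k ^ n * (A x z * \<psi> z))"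
    by (rule infsum_mono[OF outer dom inner_le])
  also have "\<dots> = k ^ n * (\<Sum>\<^sub>\<infinity>z\<in>V. A x z * \<psi> z)"
    by (rule infsum_cmult_right')
  also have "\<dots> \<le> k ^ n * (k * \<psi> x)"
    using le[OF Suc.prems] k by (intro mult_left_mono) auto
  finally show ?case
    unfolding eq using nonneg_infsum_swap(2)[OF f_nonneg inner outer] by (simp add: ac_simps)
qed

definition C :: real where
  "C = (SOME C. 0 \<le> C \<and> (\<forall>x\<in>V. (\<Sum>\<^sub>\<infinity>y\<in>V. A x y) \<le> C))"

lemma C: "0 \<le> C" "x \<in> V \<Longrightarrow> (\<Sum>\<^sub>\<infinity>y\<in>V. A x y) \<le> C"
proof -
  obtain C' where "\<forall>x\<in>V. (\<Sum>\<^sub>\<infinity>y\<in>V. A x y) \<le> C'"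
    using rows by blast
  then have "0 \<le> max 0 C' \<and> (\<forall>x\<in>V. (\<Sum>\<^sub>\<infinity>y\<in>V. A x y) \<le> max 0 C')"
    by force
  then have "0 \<le> C \<and> (\<forall>x\<in>V. (\<Sum>\<^sub>\<infinity>y\<in>V. A x y) \<le> C)"
    unfolding C_def by (rule someI)
  then show "0 \<le> C" "x \<in> V \<Longrightarrow> (\<Sum>\<^sub>\<infinity>y\<in>V. A x y) \<le> C"
    by auto
qed

lemma power_row_summable: "x \<in> V \<Longrightarrow> a n x summable_on V"
  and power_row_le: "x \<in> V \<Longrightarrow> (\<Sum>\<^sub>\<infinity>y\<in>V. a n x y) \<le> C ^ n"
  using superharmonic_power[of "\<lambda>_. 1" C x n] C row_summable by auto

lemma power_row_subset:
  assumes "x \<in> V" "Y \<subseteq> V"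
  shows "a n x summable_on Y" "0 \<le> (\<Sum>\<^sub>\<infinity>y\<in>Y. a n x y)" "(\<Sum>\<^sub>\<infinity>y\<in>Y. a n x y) \<le> C ^ n"
proof -
  show *: "a n x summable_on Y"
    using assms power_row_summable summable_on_subset_banach by blast
  show "0 \<le> (\<Sum>\<^sub>\<infinity>y\<in>Y. a n x y)"
    using assms by (intro infsum_nonneg power_nonneg) auto
  have "(\<Sum>\<^sub>\<infinity>y\<in>Y. a n x y) \<le> (\<Sum>\<^sub>\<infinity>y\<in>V. a n x y)"
    using assms * power_row_summable by (intro infsum_mono2) (auto intro: power_nonneg)
  then show "(\<Sum>\<^sub>\<infinity>y\<in>Y. a n x y) \<le> C ^ n"
    using power_row_le[of x n] assms by simp
qed

lemma power_le: "x \<in> V \<Longrightarrow> y \<in> V \<Longrightarrow> a n x y \<le> C ^ n"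
  using power_row_subset(3)[of x "{y}" n] by simp

lemma row_weighted_summable:
  assumes x: "x \<in> V" and f: "\<And>z. z \<in> V \<Longrightarrow> 0 \<le> f z" "\<And>z. z \<in> V \<Longrightarrow> f z \<le> (c :: real)"
  shows "(\<lambda>z. A x z * f z) summable_on V"
proof (rule summable_on_comparison_test)
  show "(\<lambda>z. A x z * c) summable_on V"
    by (intro summable_on_cmult_left row_summable x)
qed (use x f nonneg in \<open>auto intro: mult_left_mono\<close>)

text \<open>The left side counts only those paths from \<open>x\<close> to \<open>y\<close> that are
  at \<open>z\<close> at time \<open>m\<close>. This half of the product formula suffices for
  comparing growth rates and for bounding entries by return entries.\<close>

lemma power_add_ge:
  assumes "x \<in> V" "y \<in> V" "z \<in> V"
  shows "a m x z * a n z y \<le> a (m + n) x y"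
  using assms
proof (induction m arbitrary: x)
  case 0
  then show ?case by (auto intro: power_nonneg)
next
  case (Suc m)
  have "a (Suc m) x z * a n z y = (\<Sum>\<^sub>\<infinity>w\<in>V. A x w * a m w z) * a n z y"
    by simp
  also have "\<dots> = (\<Sum>\<^sub>\<infinity>w\<in>V. A x w * a m w z * a n z y)"
    by (rule infsum_cmult_left'[symmetric])
  also have "\<dots> \<le> (\<Sum>\<^sub>\<infinity>w\<in>V. A x w * a (m + n) w y)"
  proof (rule infsum_mono)
    show "(\<lambda>w. A x w * a m w z * a n z y) summable_on V"
      using Suc.prems
      by (intro summable_on_cmult_left row_weighted_summable[where c = "C ^ m"])
        (auto intro: power_nonneg power_le)
    show "(\<lambda>w. A x w * a (m + n) w y) summable_on V"
      using Suc.prems by (intro row_weighted_summable[where c = "C ^ (m + n)"])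
        (auto intro: power_nonneg power_le)
    show "A x w * a m w z * a n z y \<le> A x w * a (m + n) w y" if "w \<in> V" for w
      using Suc.IH[OF that] Suc.prems nonneg[OF _ that] by (auto intro: mult_left_mono simp: mult.assoc)
  qed
  finally show ?case by simp
qed

text \<open>\<open>mat_power\<close> peels off the first step of a path. Peeling off the last one
  instead is what transfers the symmetry of \<open>A\<close> to its powers.\<close>

lemma power_Suc_right:
  assumes "x \<in> V" "y \<in> V"
  shows "a (Suc n) x y = (\<Sum>\<^sub>\<infinity>z\<in>V. a n x z * A z y)"
  using assms
proof (induction n arbitrary: x)
  case 0
  have "(\<Sum>\<^sub>\<infinity>z\<in>V. A x z * (if z = y then 1 else 0)) = (\<Sum>\<^sub>\<infinity>z\<in>{y}. A x z)"
    using 0 by (intro infsum_cong_neutral) auto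
  moreover have "(\<Sum>\<^sub>\<infinity>z\<in>V. (if x = z then 1 else 0) * A z y) = (\<Sum>\<^sub>\<infinity>z\<in>{x}. A z y)"
    using 0 by (intro infsum_cong_neutral) auto
  ultimately show ?case by simp
next
  case (Suc n)
  define f where "f w z = A x w * (a n w z * A z y)" for w z
  \<comment> \<open>Nothing bounds the sum of a column, but each of its entries is one term of a row
    and hence at most \<open>C\<close>.\<close>
  have Ay: "A z y \<le> C" if "z \<in> V" for z
  proof -
    have "(\<Sum>w\<in>{y}. A z w) \<le> (\<Sum>\<^sub>\<infinity>w\<in>V. A z w)"
      using that Suc.prems by (intro finite_sum_le_infsum row_summable) (auto intro: nonneg)
    then show ?thesis using C(2)[OF that] by simp
  qed
  have f_nonneg: "0 \<le> f w z" if "w \<in> V" "z \<in> V" for w z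
    unfolding f_def using that Suc.prems by (intro mult_nonneg_nonneg nonneg power_nonneg)
  have inner: "f w summable_on V" if "w \<in> V" for w
    unfolding f_def
  proof (rule summable_on_cmult_right, rule summable_on_comparison_test)
    show "(\<lambda>z. a n w z * C) summable_on V"
      by (intro summable_on_cmult_left power_row_summable that)
  qed (use that Suc.prems Ay in \<open>auto intro!: mult_left_mono mult_nonneg_nonneg power_nonneg nonneg\<close>)
  have eq: "(\<Sum>\<^sub>\<infinity>z\<in>V. f w z) = A x w * a (Suc n) w y" if "w \<in> V" for w
    unfolding f_def infsum_cmult_right' Suc.IH[OF that Suc.prems(2)] ..
  have outer: "(\<lambda>w. \<Sum>\<^sub>\<infinity>z\<in>V. f w z) summable_on V"
  proof (subst summable_on_cong[OF eq])
    show "(\<lambda>w. A x w * a (Suc n) w y) summable_on V"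
      using Suc.prems power_nonneg power_le[of _ y "Suc n"]
      by (intro row_weighted_summable[where c = "C ^ Suc n"]) blast+
  qed
  have "a (Suc (Suc n)) x y = (\<Sum>\<^sub>\<infinity>w\<in>V. \<Sum>\<^sub>\<infinity>z\<in>V. f w z)"
    by (subst mat_power.simps, rule infsum_cong) (simp only: eq)
  also have "\<dots> = (\<Sum>\<^sub>\<infinity>z\<in>V. \<Sum>\<^sub>\<infinity>w\<in>V. f w z)"
    by (rule nonneg_infsum_swap(3)[OF f_nonneg inner outer, symmetric])
  also have "\<dots> = (\<Sum>\<^sub>\<infinity>z\<in>V. a (Suc n) x z * A z y)"
    by (simp add: f_def infsum_cmult_left' flip: mult.assoc)
  finally show ?case .
qed

lemma power_sym:
  assumes "symmetric_graph V A" "x \<in> V" "y \<in> V"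
  shows "a n x y = a n y x"
  using assms(2,3)
proof (induction n arbitrary: x y)
  case 0
  then show ?case by auto
next
  case (Suc n)
  have "a (Suc n) x y = (\<Sum>\<^sub>\<infinity>z\<in>V. a n y z * A z x)"
    unfolding mat_power.simps using Suc assms(1)
    by (intro infsum_cong) (auto simp: symmetric_graph_def)
  also have "\<dots> = a (Suc n) y x"
    using Suc.prems by (simp only: power_Suc_right)
  finally show ?case .
qed

end

section \<open>Independence of the spectral radius from the pair of vertices\<close>

locale irreducible_bounded_graph = bounded_graph +
  assumes irreducible: "irreducible_graph V A"
begin

lemma connecting_power: "x \<in> V \<Longrightarrow> y \<in> V \<Longrightarrow> \<exists>n. 0 < a n x y"
  using irreducible by (auto simp: irreducible_graph_def)

text \<open>Fixed paths from \<open>u\<close> to \<open>x\<close> and from \<open>y\<close> to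
  \<open>v\<close> extend every path from \<open>x\<close> to \<open>y\<close>, so its entries are
  dominated by those from \<open>u\<close> to \<open>v\<close> up to a constant and a shift of the
  exponent. Exponential bounds are available only strictly above the inverse radius, hence the extra
  \<open>e\<close>.\<close>

lemma inverse_conv_radius_le_any:
  assumes "x \<in> V" "y \<in> V" "u \<in> V" "v \<in> V"
  shows "inverse (conv_radius (\<lambda>n. a n x y)) \<le> inverse (conv_radius (\<lambda>n. a n u v))"
proof (rule ereal_le_real)
  fix k assume "inverse (conv_radius (\<lambda>n. a n u v)) \<le> ereal k"
  show "inverse (conv_radius (\<lambda>n. a n x y)) \<le> ereal k"
  proof (rule ereal_le_epsilon2)
    fix e :: real assume e: "0 < e"
    have less: "inverse (conv_radius (\<lambda>n. a n u v)) < ereal (k + e)"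
      using \<open>_ \<le> ereal k\<close> e by (simp add: le_less_trans)
    then obtain K where K: "0 < K" "\<And>n. \<bar>a n u v\<bar> \<le> K * (k + e) ^ n"
      by (rule power_bound_obtain) blast
    have pos: "0 < k + e"
      using less inverse_conv_radius_nonneg by (metis ereal_less(2) le_less_trans)
    obtain i j where ij: "0 < a i u x" "0 < a j y v"
      using connecting_power assms by blast
    have "inverse (conv_radius (\<lambda>n. a n x y)) \<le> ereal (k + e)"
    proof (rule inverse_conv_radius_le[OF pos])
      fix n
      have "a i u x * a n x y * a j y v \<le> a (i + n) u y * a j y v"
        using assms ij by (intro mult_right_mono power_add_ge) auto
      also have "\<dots> \<le> a (i + n + j) u v"
        using assms by (intro power_add_ge)
      also have "\<dots> \<le> K * (k + e) ^ (i + n + j)"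
        using K(2)[of "i + n + j"] by linarith
      finally have "a n x y \<le> K * (k + e) ^ (i + j) / (a i u x * a j y v) * (k + e) ^ n"
        using ij by (simp add: field_simps power_add)
      then show "\<bar>a n x y\<bar> \<le> K * (k + e) ^ (i + j) / (a i u x * a j y v) * (k + e) ^ n"
        using power_nonneg assms by (simp add: abs_of_nonneg)
    qed
    then show "inverse (conv_radius (\<lambda>n. a n x y)) \<le> ereal k + ereal e"
      by simp
  qed
qed

lemma spectral_radius_eq:
  assumes "x \<in> V" "y \<in> V"
  shows "spectral_radius V A = inverse (conv_radius (\<lambda>n. a n x y))"
  unfolding spectral_radius_def
proof (rule the_equality)
  show "\<forall>u\<in>V. \<forall>v\<in>V. inverse (conv_radius (\<lambda>n. a n x y)) = inverse (conv_radius (\<lambda>n. a n u v))"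
    using inverse_conv_radius_le_any assms by (auto intro!: antisym)
qed (use assms in blast)

lemma spectral_radius_nonneg: "0 \<le> spectral_radius V A"
  using nonempty spectral_radius_eq inverse_conv_radius_nonneg by (metis ex_in_conv)

lemma spectral_radius_le:
  assumes "x \<in> V" "y \<in> V" "0 < k" "\<And>n. a n x y \<le> K * k ^ n"
  shows "spectral_radius V A \<le> ereal k"
  unfolding spectral_radius_eq[OF assms(1,2)] using assms power_nonneg
  by (intro inverse_conv_radius_le[of k _ K]) (auto simp: abs_of_nonneg)

lemma power_summable:
  assumes "spectral_radius V A < ereal k" "x \<in> V" "y \<in> V"
  shows "summable (\<lambda>n. a n x y / k ^ n)"
  using assms(1) unfolding spectral_radius_eq[OF assms(2,3)] by (rule summable_divide_power)

lemma power_bound: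
  assumes "spectral_radius V A < ereal k" "x \<in> V" "y \<in> V"
  obtains K where "0 < K" "\<And>n. a n x y \<le> K * k ^ n"
proof -
  have "inverse (conv_radius (\<lambda>n. a n x y)) < ereal k"
    using assms(1) unfolding spectral_radius_eq[OF assms(2,3)] .
  then obtain K where "0 < K" "\<And>n. \<bar>a n x y\<bar> \<le> K * k ^ n"
    by (rule power_bound_obtain) blast
  then show thesis
    using that abs_le_D1 by blast
qed

end

section \<open>Consequences of local finiteness\<close>

context bounded_graph
begin

abbreviation neighbours :: "'a \<Rightarrow> 'a set" where
  "neighbours x \<equiv> {y \<in> V. 0 < A x y}"

lemma infsum_row_eq_sum:
  assumes "locally_finite_graph V A" "x \<in> V"
  shows "(\<Sum>\<^sub>\<infinity>y\<in>V. A x y * f y) = (\<Sum>y\<in>neighbours x. A x y * (f y :: real))"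
proof -
  have "(\<Sum>\<^sub>\<infinity>y\<in>V. A x y * f y) = (\<Sum>\<^sub>\<infinity>y\<in>neighbours x. A x y * f y)"
    using assms(2) nonneg by (intro infsum_cong_neutral) (auto simp: less_le)
  then show ?thesis
    using assms by (simp add: locally_finite_graph_def)
qed

lemma finite_power_support:
  assumes "locally_finite_graph V A" "x \<in> V"
  shows "finite {y \<in> V. 0 < a n x y}"
  using assms(2)
proof (induction n arbitrary: x)
  case 0
  have "{y \<in> V. 0 < a 0 x y} \<subseteq> {x}" by auto
  then show ?case by (rule finite_subset) simp
next
  case (Suc n)
  have "{y \<in> V. 0 < a (Suc n) x y} \<subseteq> (\<Union>z\<in>neighbours x. {y \<in> V. 0 < a n z y})"
  proof safe
    fix y assume y: "y \<in> V" "0 < a (Suc n) x y"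
    then have "0 < (\<Sum>z\<in>neighbours x. A x z * a n z y)"
      using infsum_row_eq_sum[OF assms(1) Suc.prems] by simp
    then obtain z where z: "z \<in> neighbours x" "\<not> A x z * a n z y \<le> 0"
      using sum_nonpos[of "neighbours x" "\<lambda>z. A x z * a n z y"] by force
    then have "0 < a n z y"
      using power_nonneg[of z y n] y by (auto simp: less_le)
    with z y show "y \<in> (\<Union>z\<in>neighbours x. {y \<in> V. 0 < a n z y})"
      by blast
  qed
  moreover have "finite (\<Union>z\<in>neighbours x. {y \<in> V. 0 < a n z y})"
    using assms(1) Suc by (auto simp: locally_finite_graph_def)
  ultimately show ?case by (rule finite_subset)
qed

lemma finite_graph_ball:
  assumes "locally_finite_graph V A" "x \<in> V"
  shows "finite (graph_ball V A x n)"
proof -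
  have "graph_ball V A x n = (\<Union>k\<le>n. {y \<in> V. 0 < a k x y})"
    by (auto simp: graph_ball_def)
  then show ?thesis
    using finite_power_support assms by simp
qed

end

lemma (in irreducible_bounded_graph) spectral_radius_le_eventually:
  assumes "x \<in> V" "y \<in> V" "0 < k" "0 \<le> K" and ev: "\<forall>\<^sub>F n in sequentially. a n x y \<le> K * k ^ n"
  shows "spectral_radius V A \<le> ereal k"
proof -
  obtain N where N: "\<And>n. N \<le> n \<Longrightarrow> a n x y \<le> K * k ^ n"
    using ev by (auto simp: eventually_sequentially)
  \<comment> \<open>One constant that dominates each of the finitely many ratios where the bound may
    fail.\<close>
  define M where "M = (\<Sum>m<N. a m x y / k ^ m)"
  have terms: "0 \<le> a m x y / k ^ m" for m
    using assms power_nonneg by simp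
  show ?thesis
  proof (rule spectral_radius_le[OF assms(1-3)])
    fix n
    show "a n x y \<le> (K + M) * k ^ n"
    proof (cases "N \<le> n")
      case True
      have "0 \<le> M"
        unfolding M_def by (intro sum_nonneg terms)
      then have "K * k ^ n \<le> (K + M) * k ^ n"
        using assms(3) by (intro mult_right_mono) auto
      with N[OF True] show ?thesis by linarith
    next
      case False
      then have "a n x y / k ^ n \<le> M"
        unfolding M_def using terms by (intro member_le_sum) auto
      then have "a n x y / k ^ n \<le> K + M"
        using assms(4) by linarith
      then show ?thesis
        using assms(3) by (simp add: field_simps)
    qed
  qed
qed

section \<open>The reduced graph\<close>

locale graph_action = irreducible_bounded_graph +
  fixes T :: "('a \<Rightarrow> 'a) set"
  assumes subgroup: "subgroup T (aut_group V A)"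
begin

abbreviation orb :: "'a \<Rightarrow> 'a set" where
  "orb \<equiv> vertex_orbit V A T"

abbreviation orbs :: "'a set set" where
  "orbs \<equiv> orbit_space V A T"

text \<open>Elements of \<open>Bij V\<close> are extensional, so the inverse map has to be
  restricted to \<open>V\<close> to belong to the group.\<close>

abbreviation inverse_of :: "('a \<Rightarrow> 'a) \<Rightarrow> 'a \<Rightarrow> 'a" where
  "inverse_of \<tau> \<equiv> restrict (inv_into V \<tau>) V"

lemma T_carrier: "T \<subseteq> carrier (aut_group V A)"
  using subgroup by (rule subgroup.subset)

lemma T_Bij: "\<tau> \<in> T \<Longrightarrow> \<tau> \<in> Bij V"
  and T_A: "\<tau> \<in> T \<Longrightarrow> x \<in> V \<Longrightarrow> y \<in> V \<Longrightarrow> A (\<tau> x) (\<tau> y) = A x y"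
  using T_carrier by (auto simp: aut_group_def)

lemma T_bij: "\<tau> \<in> T \<Longrightarrow> bij_betw \<tau> V V"
  using T_Bij by (auto simp: Bij_def)

lemma T_V: "\<tau> \<in> T \<Longrightarrow> x \<in> V \<Longrightarrow> \<tau> x \<in> V"
  using T_bij bij_betwE by blast

lemma T_inj: "\<tau> \<in> T \<Longrightarrow> inj_on \<tau> V"
  using T_bij bij_betw_imp_inj_on by blast

lemma T_id: "restrict (\<lambda>x. x) V \<in> T"
  using subgroup.one_closed[OF subgroup] by (simp add: aut_group_def BijGroup_def)

lemma T_compose: "\<sigma> \<in> T \<Longrightarrow> \<tau> \<in> T \<Longrightarrow> compose V \<sigma> \<tau> \<in> T"
  using subgroup.m_closed[OF subgroup, of \<sigma> \<tau>] T_Bij by (simp add: aut_group_def BijGroup_def)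

lemma T_mult: "\<sigma> \<in> T \<Longrightarrow> \<tau> \<in> T \<Longrightarrow> \<sigma> \<otimes>\<^bsub>acting_group V A T\<^esub> \<tau> = compose V \<sigma> \<tau>"
  using T_Bij by (simp add: aut_group_def BijGroup_def)

lemma inv_into_V: "\<tau> \<in> T \<Longrightarrow> x \<in> V \<Longrightarrow> inv_into V \<tau> x \<in> V"
  by (simp add: Bij_inv_into_mem T_Bij)

lemma T_inv_into: "\<tau> \<in> T \<Longrightarrow> x \<in> V \<Longrightarrow> \<tau> (inv_into V \<tau> x) = x"
  using T_bij bij_betw_inv_into_right by fastforce

lemma inv_into_T: "\<tau> \<in> T \<Longrightarrow> x \<in> V \<Longrightarrow> inv_into V \<tau> (\<tau> x) = x"
  using T_bij bij_betw_inv_into_left by fastforce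

lemma inv_into_eq_iff: "\<tau> \<in> T \<Longrightarrow> x \<in> V \<Longrightarrow> y \<in> V \<Longrightarrow> inv_into V \<tau> y = x \<longleftrightarrow> \<tau> x = y"
  using T_inv_into inv_into_T by blast

text \<open>A subgroup is closed under the abstract inverse of \<open>aut_group\<close>. That
  inverse is identified with \<open>inverse_of\<close> directly from its description in
  \<open>m_inv_def\<close>, by checking both products and uniqueness.\<close>

lemma T_inverse:
  assumes "\<tau> \<in> T"
  shows "inverse_of \<tau> \<in> T"
proof -
  let ?G = "aut_group V A"
  have Bij: "\<tau> \<in> Bij V" "inverse_of \<tau> \<in> Bij V"
    using assms T_Bij restrict_inv_into_Bij by auto
  have A: "A (inverse_of \<tau> x) (inverse_of \<tau> y) = A x y" if "x \<in> V" "y \<in> V" for x y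
    using T_A[OF assms, of "inv_into V \<tau> x" "inv_into V \<tau> y"] that assms
    by (simp add: inv_into_V T_inv_into)
  have carrier: "inverse_of \<tau> \<in> carrier ?G"
    using Bij A by (simp add: aut_group_def)
  have left: "compose V (inverse_of \<tau>) \<tau> = restrict (\<lambda>x. x) V"
    using Bij by (simp add: Bij_compose_restrict_eq)
  have right: "compose V \<tau> (inverse_of \<tau>) = restrict (\<lambda>x. x) V"
    using assms by (auto simp: compose_def fun_eq_iff T_inv_into inv_into_V)
  have "inv\<^bsub>?G\<^esub> \<tau> = inverse_of \<tau>"
    unfolding m_inv_def
  proof (rule the_equality)
    show "inverse_of \<tau> \<in> carrier ?G \<and> \<tau> \<otimes>\<^bsub>?G\<^esub> inverse_of \<tau> = \<one>\<^bsub>?G\<^esub> \<and> inverse_of \<tau> \<otimes>\<^bsub>?G\<^esub> \<tau> = \<one>\<^bsub>?G\<^esub>"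
      using carrier left right Bij by (simp add: aut_group_def BijGroup_def)
  next
    fix \<sigma> assume \<sigma>: "\<sigma> \<in> carrier ?G \<and> \<tau> \<otimes>\<^bsub>?G\<^esub> \<sigma> = \<one>\<^bsub>?G\<^esub> \<and> \<sigma> \<otimes>\<^bsub>?G\<^esub> \<tau> = \<one>\<^bsub>?G\<^esub>"
    then have \<sigma>_Bij: "\<sigma> \<in> Bij V"
      by (simp add: aut_group_def)
    with \<sigma> have "compose V \<tau> \<sigma> = restrict (\<lambda>x. x) V"
      using Bij by (simp add: aut_group_def BijGroup_def)
    then have "\<tau> (\<sigma> x) = x" if "x \<in> V" for x
      using that by (metis compose_eq restrict_apply')
    then have "\<sigma> x = inverse_of \<tau> x" if "x \<in> V" for x
      using that \<sigma>_Bij inv_into_T[OF assms, of "\<sigma> x"] Bij_imp_funcset by fastforce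
    then show "\<sigma> = inverse_of \<tau>"
      using \<sigma>_Bij by (intro extensionalityI[of _ V]) (auto simp: Bij_def)
  qed
  then show ?thesis
    using subgroup.m_inv_closed[OF subgroup assms] by simp
qed

lemma orb_eq: "orb x = (\<lambda>\<tau>. \<tau> x) ` T"
  by (auto simp: orbit_def)

lemma orbs_eq: "orbs = orb ` V"
  by (auto simp: orbits_def)

lemma orb_self: "x \<in> V \<Longrightarrow> x \<in> orb x"
  unfolding orb_eq by (rule image_eqI[OF _ T_id]) simp

lemma orb_subset: "x \<in> V \<Longrightarrow> orb x \<subseteq> V"
  using T_V by (auto simp: orb_eq)

lemma orb_T: "\<tau> \<in> T \<Longrightarrow> x \<in> V \<Longrightarrow> orb (\<tau> x) = orb x"
proof -
  have sub: "orb (\<tau> x) \<subseteq> orb x" if "\<tau> \<in> T" "x \<in> V" for \<tau> x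
  proof
    fix y assume "y \<in> orb (\<tau> x)"
    then obtain \<sigma> where "\<sigma> \<in> T" "y = \<sigma> (\<tau> x)"
      by (auto simp: orb_eq)
    then show "y \<in> orb x"
      using T_compose[of \<sigma> \<tau>] that
      by (auto simp: orb_eq compose_eq intro!: image_eqI[of _ _ "compose V \<sigma> \<tau>"])
  qed
  assume "\<tau> \<in> T" "x \<in> V"
  with sub[of \<tau> x] sub[OF T_inverse[of \<tau>], of "\<tau> x"] show ?thesis
    by (simp add: T_V inv_into_T)
qed

lemma orb_eqI: "y \<in> orb x \<Longrightarrow> x \<in> V \<Longrightarrow> orb y = orb x"
  using orb_T by (auto simp: orb_eq[of x])

lemma mem_orbs: "Y \<in> orbs \<Longrightarrow> y \<in> Y \<Longrightarrow> y \<in> V \<and> Y = orb y"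
  using orb_eqI orb_subset by (fastforce simp: orbs_eq)

lemma orbs_subset: "Y \<in> orbs \<Longrightarrow> Y \<subseteq> V"
  using mem_orbs by blast

lemma orb_in_orbs: "x \<in> V \<Longrightarrow> orb x \<in> orbs"
  by (auto simp: orbs_eq)

lemma mem_orbs_iff: "Y \<in> orbs \<Longrightarrow> y \<in> V \<Longrightarrow> y \<in> Y \<longleftrightarrow> orb y = Y"
  using mem_orbs orb_self by blast

lemma bij_betw_orbit:
  assumes "\<tau> \<in> T" "Y \<in> orbs"
  shows "bij_betw \<tau> Y Y"
proof (rule bij_betw_imageI)
  have Y: "Y \<subseteq> V"
    using assms orbs_subset by blast
  then show "inj_on \<tau> Y"
    using T_inj[OF assms(1)] inj_on_subset by blast
  have sub: "\<sigma> ` Y \<subseteq> Y" if "\<sigma> \<in> T" for \<sigma>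
  proof safe
    fix y assume "y \<in> Y"
    then have y: "y \<in> V" "orb y = Y"
      using mem_orbs[OF assms(2)] by auto
    then show "\<sigma> y \<in> Y"
      using orb_self[OF T_V[OF that y(1)]] orb_T[OF that y(1)] by simp
  qed
  show "\<tau> ` Y = Y"
  proof
    show "Y \<subseteq> \<tau> ` Y"
    proof
      fix y assume "y \<in> Y"
      then have "inv_into V \<tau> y \<in> Y" "\<tau> (inv_into V \<tau> y) = y"
        using sub[OF T_inverse[OF assms(1)]] Y T_inv_into[OF assms(1)] by auto
      then show "y \<in> \<tau> ` Y" by force
    qed
  qed (rule sub[OF assms(1)])
qed

text \<open>Moving \<open>x\<close> by an element of \<open>T\<close> only permutes the summation
  set \<open>Y\<close>, so all representatives give the same sum and the description operator has a
  unique value to pick.\<close>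

lemma reduced_matrix_eq:
  assumes "x \<in> V" "Y \<in> orbs"
  shows "reduced_matrix A (orb x) Y = (\<Sum>\<^sub>\<infinity>y\<in>Y. A x y)"
  unfolding reduced_matrix_def
proof (rule the_equality)
  show "\<forall>x'\<in>orb x. (\<Sum>\<^sub>\<infinity>y\<in>Y. A x y) = (\<Sum>\<^sub>\<infinity>y\<in>Y. A x' y)"
  proof
    fix x' assume "x' \<in> orb x"
    then obtain \<tau> where \<tau>: "\<tau> \<in> T" "x' = \<tau> x"
      by (auto simp: orb_eq)
    have "(\<Sum>\<^sub>\<infinity>y\<in>Y. A x y) = (\<Sum>\<^sub>\<infinity>y\<in>Y. A (\<tau> x) (\<tau> y))"
      using orbs_subset[OF assms(2)] T_A[OF \<tau>(1) assms(1)] by (intro infsum_cong) auto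
    also have "\<dots> = (\<Sum>\<^sub>\<infinity>y\<in>Y. A (\<tau> x) y)"
      by (rule infsum_reindex_bij_betw[OF bij_betw_orbit[OF \<tau>(1) assms(2)]])
    finally show "(\<Sum>\<^sub>\<infinity>y\<in>Y. A x y) = (\<Sum>\<^sub>\<infinity>y\<in>Y. A x' y)"
      using \<tau> by simp
  qed
qed (use orb_self assms in blast)

text \<open>The link between the two graphs: a row of the reduced matrix acts on
  \<open>\<phi>\<close> as the row of \<open>A\<close> acts on the lift of \<open>\<phi>\<close>,
  because the sum over \<open>V\<close> can be taken orbit by orbit. Constant \<open>\<phi>\<close>
  gives the row sums, other choices give the powers and the transfer of sub- and superharmonic
  functions.\<close>

lemma reduced_row_has_sum:
  assumes x: "x \<in> V" and sum: "(\<lambda>y. A x y * \<phi> (orb y)) summable_on V"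
  shows "((\<lambda>Y. reduced_matrix A (orb x) Y * \<phi> Y) has_sum (\<Sum>\<^sub>\<infinity>y\<in>V. A x y * \<phi> (orb y))) orbs"
proof -
  define f where "f y = A x y * \<phi> (orb y)" for y
  \<comment> \<open>The orbits partition \<open>V\<close>, so their disjoint union is
    \<open>V\<close> itself.\<close>
  have bij: "bij_betw snd (Sigma orbs (\<lambda>Y. Y)) V"
  proof (rule bij_betw_imageI)
    show "inj_on snd (Sigma orbs (\<lambda>Y. Y))"
      using mem_orbs by (auto simp: inj_on_def)
    show "snd ` Sigma orbs (\<lambda>Y. Y) = V"
    proof (intro equalityI subsetI)
      fix y assume "y \<in> V"
      then have "(orb y, y) \<in> Sigma orbs (\<lambda>Y. Y)"
        using orb_self orb_in_orbs by blast
      then show "y \<in> snd ` Sigma orbs (\<lambda>Y. Y)"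
        by (rule image_eqI[rotated]) simp
    qed (auto dest: mem_orbs)
  qed
  have "(f has_sum infsum f V) V"
    using sum unfolding f_def[abs_def] by (rule has_sum_infsum)
  then have "((\<lambda>p. f (snd p)) has_sum infsum f V) (Sigma orbs (\<lambda>Y. Y))"
    by (simp add: has_sum_reindex_bij_betw[OF bij])
  then have "((\<lambda>Y. reduced_matrix A (orb x) Y * \<phi> Y) has_sum infsum f V) orbs"
  proof (rule has_sum_SigmaD)
    fix Y assume Y: "Y \<in> orbs"
    then have "A x summable_on Y"
      using summable_on_subset_banach[OF row_summable[OF x] orbs_subset] by blast
    then have "(A x has_sum reduced_matrix A (orb x) Y) Y"
      using reduced_matrix_eq[OF x Y] by simp
    then have "((\<lambda>y. A x y * \<phi> Y) has_sum reduced_matrix A (orb x) Y * \<phi> Y) Y"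
      by (rule has_sum_cmult_left)
    then show "((\<lambda>y. f (snd (Y, y))) has_sum reduced_matrix A (orb x) Y * \<phi> Y) Y"
      by (subst has_sum_cong[where g = "\<lambda>y. A x y * \<phi> Y"]) (use Y mem_orbs in \<open>auto simp: f_def\<close>)
  qed
  then show ?thesis
    by (simp add: f_def[abs_def])
qed

lemma reduced_bounded_graph: "bounded_graph orbs (reduced_matrix A)"
proof
  have nonneg_red: "0 \<le> reduced_matrix A X Y" if "X \<in> orbs" "Y \<in> orbs" for X Y
    using that orbs_subset by (auto simp: orbs_eq reduced_matrix_eq orb_in_orbs intro!: infsum_nonneg nonneg dest: subsetD[OF orb_subset])
  then show "weighted_graph orbs (reduced_matrix A)"
    using nonempty by (auto simp: weighted_graph_def orbs_eq)
  show "\<exists>C. \<forall>X\<in>orbs. reduced_matrix A X summable_on orbs \<and> (\<Sum>\<^sub>\<infinity>Y\<in>orbs. reduced_matrix A X Y) \<le> C"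
  proof (intro exI ballI)
    fix X assume "X \<in> orbs"
    then obtain x where x: "x \<in> V" "X = orb x"
      by (auto simp: orbs_eq)
    have "(reduced_matrix A X has_sum (\<Sum>\<^sub>\<infinity>y\<in>V. A x y)) orbs"
      using reduced_row_has_sum[of x "\<lambda>_. 1"] row_summable x by simp
    then show "reduced_matrix A X summable_on orbs \<and> (\<Sum>\<^sub>\<infinity>Y\<in>orbs. reduced_matrix A X Y) \<le> C"
      using C(2)[OF x(1)] by (auto simp: infsumI has_sum_imp_summable)
  qed
qed

text \<open>By induction the sum over \<open>Y\<close> of row \<open>z\<close> of the n-th power
  depends only on the orbit of \<open>z\<close>, being the lift of a column of the reduced power.
  \<open>reduced_row_has_sum\<close> then turns one reduced step into one step of \<open>A\<close>,
  and Tonelli moves the sum over \<open>Y\<close> outside.\<close>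

lemma reduced_power_eq:
  assumes "x \<in> V" "Y \<in> orbs"
  shows "mat_power orbs (reduced_matrix A) n (orb x) Y = (\<Sum>\<^sub>\<infinity>y\<in>Y. a n x y)"
  using assms(1)
proof (induction n arbitrary: x)
  case 0
  show ?case
  proof (cases "x \<in> Y")
    case True
    then have "(\<Sum>\<^sub>\<infinity>y\<in>Y. a 0 x y) = (\<Sum>\<^sub>\<infinity>y\<in>{x}. 1)"
      by (intro infsum_cong_neutral) auto
    then show ?thesis
      using True mem_orbs[OF assms(2) True] by simp
  next
    case False
    then have "(\<Sum>\<^sub>\<infinity>y\<in>Y. a 0 x y) = 0"
      by (intro infsum_0) auto
    then show ?thesis
      using False mem_orbs_iff[OF assms(2) 0] by simp
  qed
next
  case (Suc n)
  note Y = orbs_subset[OF assms(2)]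
  define f where "f z y = A x z * a n z y" for z y
  have f_nonneg: "0 \<le> f z y" if "z \<in> V" "y \<in> Y" for z y
    unfolding f_def using that Suc.prems Y by (intro mult_nonneg_nonneg nonneg power_nonneg) auto
  have inner: "f z summable_on Y" if "z \<in> V" for z
    unfolding f_def using that Y by (intro summable_on_cmult_right power_row_subset)
  have inner_eq: "(\<Sum>\<^sub>\<infinity>y\<in>Y. f z y) = A x z * (\<Sum>\<^sub>\<infinity>y\<in>Y. a n z y)" for z
    unfolding f_def by (rule infsum_cmult_right')
  have outer: "(\<lambda>z. \<Sum>\<^sub>\<infinity>y\<in>Y. f z y) summable_on V"
    unfolding inner_eq using Suc.prems Y
    by (intro row_weighted_summable[where c = "C ^ n"] power_row_subset)
  have outer': "(\<lambda>z. A x z * mat_power orbs (reduced_matrix A) n (orb z) Y) summable_on V"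
    using outer unfolding inner_eq by (rule summable_on_cong[THEN iffD2, rotated]) (simp add: Suc.IH)
  have "mat_power orbs (reduced_matrix A) (Suc n) (orb x) Y =
      (\<Sum>\<^sub>\<infinity>z\<in>V. A x z * mat_power orbs (reduced_matrix A) n (orb z) Y)"
    using reduced_row_has_sum[OF Suc.prems outer'] by (simp add: infsumI)
  also have "\<dots> = (\<Sum>\<^sub>\<infinity>z\<in>V. \<Sum>\<^sub>\<infinity>y\<in>Y. f z y)"
    unfolding inner_eq by (intro infsum_cong) (simp add: Suc.IH)
  also have "\<dots> = (\<Sum>\<^sub>\<infinity>y\<in>Y. a (Suc n) x y)"
    using nonneg_infsum_swap(3)[OF f_nonneg inner outer] by (simp add: f_def)
  finally show ?case .
qed

lemma power_le_reduced_power: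
  assumes "x \<in> V" "y \<in> V"
  shows "a n x y \<le> mat_power orbs (reduced_matrix A) n (orb x) (orb y)"
proof -
  have "(\<Sum>y\<in>{y}. a n x y) \<le> (\<Sum>\<^sub>\<infinity>y\<in>orb y. a n x y)"
    using assms orb_self orb_subset[OF assms(2)]
    by (intro finite_sum_le_infsum power_row_subset(1)) (auto intro: power_nonneg)
  then show ?thesis
    using assms by (simp add: reduced_power_eq orb_in_orbs)
qed

sublocale red: irreducible_bounded_graph orbs "reduced_matrix A"
proof -
  interpret red: bounded_graph orbs "reduced_matrix A"
    by (rule reduced_bounded_graph)
  show "irreducible_bounded_graph orbs (reduced_matrix A)"
  proof
    show "irreducible_graph orbs (reduced_matrix A)"
      unfolding irreducible_graph_def
    proof safe
      fix X Y assume "X \<in> orbs" "Y \<in> orbs"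
      then obtain x y where "x \<in> V" "X = orb x" "y \<in> V" "Y = orb y"
        by (auto simp: orbs_eq)
      then show "\<exists>n. 0 < red.a n X Y"
        using connecting_power power_le_reduced_power less_le_trans by blast
    qed
  qed
qed

lemma spectral_radius_le_reduced: "spectral_radius V A \<le> spectral_radius orbs (reduced_matrix A)"
proof (rule ccontr)
  assume "\<not> ?thesis"
  then obtain k where k: "spectral_radius orbs (reduced_matrix A) < ereal k" "ereal k < spectral_radius V A"
    using ereal_dense2[of "spectral_radius orbs (reduced_matrix A)" "spectral_radius V A"]
    unfolding not_le by blast
  then have "0 < k"
    using red.spectral_radius_nonneg by (metis ereal_less(2) le_less_trans)
  obtain x where x: "x \<in> V"
    using nonempty by blast
  obtain K where K: "0 < K" "\<And>n. mat_power orbs (reduced_matrix A) n (orb x) (orb x) \<le> K * k ^ n"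
    using red.power_bound[OF k(1) orb_in_orbs[OF x] orb_in_orbs[OF x]] by blast
  have "spectral_radius V A \<le> ereal k"
    using K(2) power_le_reduced_power[OF x x] order_trans
    by (intro spectral_radius_le[OF x x \<open>0 < k\<close>, of K]) blast
  with k show False by simp
qed


text \<open>The common frame of (i) to (iii): a number strictly above the spectral radius leaves
  room for constants and subexponential factors.\<close>

lemma spectral_radius_eq_reducedI:
  assumes "\<And>k. spectral_radius V A < ereal k \<Longrightarrow> 0 < k \<Longrightarrow> spectral_radius orbs (reduced_matrix A) \<le> ereal k"
  shows "spectral_radius V A = spectral_radius orbs (reduced_matrix A)"
proof (rule ccontr)
  assume "\<not> ?thesis"
  then have "spectral_radius V A < spectral_radius orbs (reduced_matrix A)"
    using spectral_radius_le_reduced by simp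
  then obtain k where k: "spectral_radius V A < ereal k" "ereal k < spectral_radius orbs (reduced_matrix A)"
    using ereal_dense2 by blast
  then have "0 < k"
    using spectral_radius_nonneg by (metis ereal_less(2) le_less_trans)
  with assms k show False
    by (meson leD)
qed

section \<open>Conditions (i), (iii) and (ii), in this order\<close>

lemma spectral_radius_eq_if_finite_orbit:
  assumes x: "x \<in> V" and fin: "finite (orb x)"
  shows "spectral_radius V A = spectral_radius orbs (reduced_matrix A)"
proof (rule spectral_radius_eq_reducedI)
  fix k assume k: "spectral_radius V A < ereal k" "0 < k"
  \<comment> \<open>Each target vertex has its own constant. The orbit is finite, so the constants
    can simply be added, without any uniformity.\<close>
  have "\<forall>y\<in>orb x. \<exists>K. \<forall>n. a n x y \<le> K * k ^ n"
    using power_bound[OF k(1) x] orb_subset[OF x] by (metis subsetD)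
  then obtain K where K: "\<And>y n. y \<in> orb x \<Longrightarrow> a n x y \<le> K y * k ^ n"
    by metis
  show "spectral_radius orbs (reduced_matrix A) \<le> ereal k"
  proof (rule red.spectral_radius_le[OF orb_in_orbs[OF x] orb_in_orbs[OF x] k(2)])
    fix n
    have "red.a n (orb x) (orb x) = (\<Sum>y\<in>orb x. a n x y)"
      using fin by (simp add: reduced_power_eq x orb_in_orbs)
    also have "\<dots> \<le> (\<Sum>y\<in>orb x. K y) * k ^ n"
      unfolding sum_distrib_right by (intro sum_mono K)
    finally show "red.a n (orb x) (orb x) \<le> (\<Sum>y\<in>orb x. K y) * k ^ n" .
  qed
qed

lemma spectral_radius_eq_if_superharmonic:
  assumes pos: "\<And>x. x \<in> V \<Longrightarrow> 0 < \<psi> x"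
    and inv: "\<And>\<tau> x. \<tau> \<in> T \<Longrightarrow> x \<in> V \<Longrightarrow> \<psi> (\<tau> x) = \<psi> x"
    and sum: "\<And>x. x \<in> V \<Longrightarrow> (\<lambda>y. A x y * \<psi> y) summable_on V"
    and le: "\<And>x. x \<in> V \<Longrightarrow> ereal (\<Sum>\<^sub>\<infinity>y\<in>V. A x y * \<psi> y) \<le> spectral_radius V A * ereal (\<psi> x)"
  shows "spectral_radius V A = spectral_radius orbs (reduced_matrix A)"
proof (rule spectral_radius_eq_reducedI)
  fix k assume k: "spectral_radius V A < ereal k" "0 < k"
  \<comment> \<open>The value at an arbitrary representative; invariance of \<open>\<psi>\<close>
    makes the choice immaterial.\<close>
  define \<phi> where "\<phi> Y = \<psi> (SOME y. y \<in> Y)" for Y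
  have \<phi>: "\<phi> (orb x) = \<psi> x" if "x \<in> V" for x
  proof -
    have "(SOME y. y \<in> orb x) \<in> orb x"
      using orb_self[OF that] by (rule someI)
    then show ?thesis
      using inv that by (auto simp: \<phi>_def orb_eq)
  qed
  have \<phi>_pos: "0 < \<phi> Y" if Y: "Y \<in> orbs" for Y
  proof -
    obtain y where "y \<in> V" "Y = orb y"
      using Y by (auto simp: orbs_eq)
    then show ?thesis
      using pos \<phi> by simp
  qed
  have le_k: "(\<Sum>\<^sub>\<infinity>y\<in>V. A x y * \<psi> y) \<le> k * \<psi> x" if x: "x \<in> V" for x
  proof -
    have "spectral_radius V A * ereal (\<psi> x) \<le> ereal k * ereal (\<psi> x)"
      using k pos[OF x] by (intro ereal_mult_right_mono) auto
    with le[OF x] have "ereal (\<Sum>\<^sub>\<infinity>y\<in>V. A x y * \<psi> y) \<le> ereal (k * \<psi> x)"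
      by (metis order_trans times_ereal.simps(1))
    then show ?thesis by simp
  qed
  have red: "((\<lambda>Y. reduced_matrix A (orb x) Y * \<phi> Y) has_sum (\<Sum>\<^sub>\<infinity>y\<in>V. A x y * \<psi> y)) orbs"
    if x: "x \<in> V" for x
  proof -
    have eq: "A x y * \<phi> (orb y) = A x y * \<psi> y" if "y \<in> V" for y
      using \<phi> that by simp
    have "(\<lambda>y. A x y * \<phi> (orb y)) summable_on V"
      using sum[OF x] summable_on_cong[of V "\<lambda>y. A x y * \<phi> (orb y)", OF eq] by simp
    moreover have "(\<Sum>\<^sub>\<infinity>y\<in>V. A x y * \<phi> (orb y)) = (\<Sum>\<^sub>\<infinity>y\<in>V. A x y * \<psi> y)"
      by (rule infsum_cong[OF eq])
    ultimately show ?thesis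
      using reduced_row_has_sum[OF x, of \<phi>] by simp
  qed
  obtain x where x: "x \<in> V"
    using nonempty by blast
  show "spectral_radius orbs (reduced_matrix A) \<le> ereal k"
  proof (rule red.spectral_radius_le[OF orb_in_orbs[OF x] orb_in_orbs[OF x] k(2)])
    fix n
    have *: "(\<lambda>Y. red.a n (orb x) Y * \<phi> Y) summable_on orbs \<and>
        (\<Sum>\<^sub>\<infinity>Y\<in>orbs. red.a n (orb x) Y * \<phi> Y) \<le> k ^ n * \<phi> (orb x)"
    proof (rule red.superharmonic_power)
      fix X assume "X \<in> orbs"
      then obtain z where z: "z \<in> V" "X = orb z"
        by (auto simp: orbs_eq)
      then show "0 < \<phi> X" "(\<lambda>Y. reduced_matrix A X Y * \<phi> Y) summable_on orbs"
        "(\<Sum>\<^sub>\<infinity>Y\<in>orbs. reduced_matrix A X Y * \<phi> Y) \<le> k * \<phi> X"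
        using has_sum_imp_summable[OF red[OF z(1)]] infsumI[OF red[OF z(1)]]
          le_k[OF z(1)] pos[OF z(1)] \<phi>[OF z(1)] by simp_all
    qed (use k orb_in_orbs x in auto)
    \<comment> \<open>All terms are nonnegative, so the return entry alone obeys the bound, and the
      factor \<open>\<phi> (orb x)\<close> cancels.\<close>
    have "(\<Sum>Y\<in>{orb x}. red.a n (orb x) Y * \<phi> Y) \<le> (\<Sum>\<^sub>\<infinity>Y\<in>orbs. red.a n (orb x) Y * \<phi> Y)"
    proof (rule finite_sum_le_infsum)
      fix Y assume "Y \<in> orbs - {orb x}"
      then show "0 \<le> red.a n (orb x) Y * \<phi> Y"
        using red.power_nonneg[OF orb_in_orbs[OF x], of Y n] \<phi>_pos[of Y]
        by (intro mult_nonneg_nonneg) auto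
    qed (use * orb_in_orbs x in auto)
    with * have "red.a n (orb x) (orb x) * \<phi> (orb x) \<le> k ^ n * \<phi> (orb x)"
      by simp
    then show "red.a n (orb x) (orb x) \<le> 1 * k ^ n"
      using \<phi>[OF x] pos[OF x] by simp
  qed
qed

lemma spectral_radius_eq_if_subexponential_orbit:
  assumes lf: "locally_finite_graph V A" and sym: "symmetric_graph V A"
    and x0: "x0 \<in> V" and x: "x \<in> V"
    and lim: "(\<lambda>n. ln (real (card (graph_ball V A x0 n \<inter> orb x))) / real n) \<longlonglongrightarrow> 0"
  shows "spectral_radius V A = spectral_radius orbs (reduced_matrix A)"
proof (rule spectral_radius_eq_reducedI)
  fix k assume k: "spectral_radius V A < ereal k" "0 < k"
  \<comment> \<open>Room between \<open>l\<close> and \<open>k\<close>: the factor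
    \<open>(k / l) ^ n\<close> will absorb the number of vertices of the orbit in the ball.\<close>
  obtain l where l: "spectral_radius V A < ereal l" "l < k"
    using ereal_dense2[OF k(1)] by auto
  then have "0 < l"
    using spectral_radius_nonneg by (metis ereal_less(2) le_less_trans)
  obtain K where K: "0 < K" "\<And>n. a n x0 x0 \<le> K * l ^ n"
    using power_bound[OF l(1) x0 x0] by blast
  define N where "N n = card (graph_ball V A x0 n \<inter> orb x)" for n
  \<comment> \<open>Going to \<open>y\<close> and back bounds the entry by a return entry at
    \<open>x0\<close>. Hence a single constant serves all \<open>y\<close>, which
    \<open>power_bound\<close> alone would not give.\<close>
  have entry: "a n x0 y \<le> sqrt K * l ^ n" if y: "y \<in> V" for n y
  proof -
    have "a n x0 y * a n x0 y \<le> a (n + n) x0 x0"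
      using power_add_ge[OF x0 x0 y, of n n] power_sym[OF sym x0 y] by simp
    also have "\<dots> \<le> (sqrt K * l ^ n)\<^sup>2"
    proof -
      have "(sqrt K * l ^ n)\<^sup>2 = K * l ^ (n + n)"
        using K(1) by (simp add: power_mult_distrib flip: power_mult power_add mult_2_right)
      then show ?thesis
        using K(2) by simp
    qed
    finally have "(a n x0 y)\<^sup>2 \<le> (sqrt K * l ^ n)\<^sup>2"
      unfolding power2_eq_square[of "a n x0 y"] .
    then show ?thesis
      by (rule power2_le_imp_le) (use K(1) \<open>0 < l\<close> in simp)
  qed
  have le: "red.a n (orb x0) (orb x) \<le> real (N n) * (sqrt K * l ^ n)" for n
  proof -
    have "red.a n (orb x0) (orb x) = (\<Sum>\<^sub>\<infinity>y\<in>orb x. a n x0 y)"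
      by (simp add: reduced_power_eq x x0 orb_in_orbs)
    also have "\<dots> = (\<Sum>\<^sub>\<infinity>y\<in>graph_ball V A x0 n \<inter> orb x. a n x0 y)"
    proof (rule infsum_cong_neutral)
      fix y assume "y \<in> orb x - graph_ball V A x0 n \<inter> orb x"
      then have "y \<in> V" "\<not> 0 < a n x0 y"
        using orb_subset[OF x] by (auto simp: graph_ball_def)
      then show "a n x0 y = 0"
        using power_nonneg[OF x0, of y n] by simp
    qed auto
    also have "\<dots> = (\<Sum>y\<in>graph_ball V A x0 n \<inter> orb x. a n x0 y)"
      using finite_graph_ball[OF lf x0] by simp
    also have "\<dots> \<le> real (N n) * (sqrt K * l ^ n)"
      unfolding N_def using entry orb_subset[OF x] by (intro sum_bounded_above) auto
    finally show ?thesis .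
  qed
  have "\<forall>\<^sub>F n in sequentially. ln (real (N n)) / real n < ln (k / l)"
    using lim l \<open>0 < l\<close> unfolding N_def by (intro order_tendstoD) (auto simp: ln_gt_zero)
  then have ev: "\<forall>\<^sub>F n in sequentially. red.a n (orb x0) (orb x) \<le> sqrt K * k ^ n"
    using eventually_gt_at_top[of 0]
  proof eventually_elim
    case (elim n)
    have "real (N n) \<le> (k / l) ^ n"
    \<comment> \<open>The logarithm carries no information when the ball misses the orbit, but then
      the count is 0 and the claim is trivial.\<close>
    proof (cases "N n = 0")
      case False
      have "ln (real (N n)) \<le> real n * ln (k / l)"
        using elim by (simp add: field_simps)
      also have "\<dots> = ln ((k / l) ^ n)"
        using k \<open>0 < l\<close> by (simp add: ln_realpow)
      finally show ?thesis
        using False k \<open>0 < l\<close> by (subst (asm) ln_le_cancel_iff) auto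
    qed (use k \<open>0 < l\<close> in auto)
    then have "real (N n) * (sqrt K * l ^ n) \<le> (k / l) ^ n * (sqrt K * l ^ n)"
      using K(1) \<open>0 < l\<close> by (intro mult_right_mono) auto
    also have "\<dots> = sqrt K * k ^ n"
      using \<open>0 < l\<close> by (simp add: power_divide)
    finally show ?case
      using le[of n] by linarith
  qed
  show "spectral_radius orbs (reduced_matrix A) \<le> ereal k"
    by (rule red.spectral_radius_le_eventually[OF orb_in_orbs[OF x0] orb_in_orbs[OF x] k(2) _ ev])
      (use K(1) in auto)
qed

end

section \<open>Super- and subharmonic functions\<close>

context irreducible_bounded_graph
begin

text \<open>The Green function with pole \<open>v\<close> converges at 1/\<open>k\<close> because
  \<open>k\<close> exceeds the spectral radius, and irreducibility makes it positive everywhere. A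
  shift of the index gives A g = k (g - delta), where delta is the indicator of \<open>v\<close>.
  Local finiteness makes each row a finite sum, which may be exchanged with the series.\<close>

lemma obtain_superharmonic:
  assumes lf: "locally_finite_graph V A" and k: "spectral_radius V A < ereal k"
  obtains g where "\<And>x. x \<in> V \<Longrightarrow> 0 < g x"
    "\<And>x. x \<in> V \<Longrightarrow> (\<Sum>y\<in>neighbours x. A x y * g y) \<le> k * g x"
proof -
  obtain v where v: "v \<in> V"
    using nonempty by blast
  have k_pos: "0 < k"
    using k spectral_radius_nonneg by (metis ereal_less(2) le_less_trans)
  define g where "g x = (\<Sum>n. a n x v / k ^ n)" for x
  have sum: "summable (\<lambda>n. a n x v / k ^ n)" if "x \<in> V" for x
    by (rule power_summable[OF k that v])
  have terms: "0 \<le> a n x v / k ^ n" if "x \<in> V" for n x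
    using power_nonneg[OF that v] k_pos by simp
  show thesis
  proof
    fix x assume x: "x \<in> V"
    obtain i where "0 < a i x v"
      using connecting_power[OF x v] by blast
    then show "0 < g x"
      unfolding g_def using k_pos terms[OF x] by (intro suminf_pos2[OF sum[OF x], of i]) auto
    have "(\<Sum>y\<in>neighbours x. A x y * g y) = (\<Sum>n. \<Sum>y\<in>neighbours x. A x y * (a n y v / k ^ n))"
    proof -
      have "A x y * g y = (\<Sum>n. A x y * (a n y v / k ^ n))" if "y \<in> neighbours x" for y
        unfolding g_def using that by (intro suminf_mult[symmetric] sum) auto
      then have "(\<Sum>y\<in>neighbours x. A x y * g y) = (\<Sum>y\<in>neighbours x. \<Sum>n. A x y * (a n y v / k ^ n))"
        by (rule sum.cong[OF refl])
      also have "\<dots> = (\<Sum>n. \<Sum>y\<in>neighbours x. A x y * (a n y v / k ^ n))"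
        by (intro suminf_sum[symmetric] summable_mult sum) auto
      finally show ?thesis .
    qed
    also have "\<dots> = (\<Sum>n. k * (a (Suc n) x v / k ^ Suc n))"
    proof (rule arg_cong[where f = suminf], rule ext)
      fix n
      have "(\<Sum>y\<in>neighbours x. A x y * (a n y v / k ^ n)) = a (Suc n) x v / k ^ n"
        by (simp add: infsum_row_eq_sum[OF lf x] sum_divide_distrib)
      then show "(\<Sum>y\<in>neighbours x. A x y * (a n y v / k ^ n)) = k * (a (Suc n) x v / k ^ Suc n)"
        using k_pos by simp
    qed
    also have "\<dots> = k * (\<Sum>n. a (Suc n) x v / k ^ Suc n)"
      using sum[OF x] by (intro suminf_mult) (subst summable_Suc_iff)
    also have "\<dots> = k * (g x - a 0 x v / k ^ 0)"
      unfolding g_def by (subst suminf_split_head[OF sum[OF x]]) simp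
    also have "\<dots> \<le> k * g x"
      using k_pos terms[OF x, of 0] by (intro mult_left_mono) auto
    finally show "(\<Sum>y\<in>neighbours x. A x y * g y) \<le> k * g x" .
  qed
qed

text \<open>A substitute for a Perron eigenvector, made of finitely many powers. A number below the
  spectral radius is beaten by some return entry at \<open>v\<close>, and this gain suffices for a
  subharmonic function.\<close>

lemma obtain_subharmonic:
  assumes fin: "finite V" and s: "0 < s" "ereal s < spectral_radius V A"
  obtains h where "\<And>x. x \<in> V \<Longrightarrow> 0 < h x" "\<And>x. x \<in> V \<Longrightarrow> s * h x \<le> (\<Sum>y\<in>V. A x y * h y)"
proof -
  obtain v where v: "v \<in> V"
    using nonempty by blast
  have "\<exists>n. s ^ n < a n v v"
  proof (rule ccontr)
    assume "\<not> ?thesis"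
    then have "spectral_radius V A \<le> ereal s"
      using s by (intro spectral_radius_le[OF v v, of s 1]) (auto simp: not_less)
    with s show False by simp
  qed
  then obtain n where n: "s ^ n < a n v v" by blast
  have Suc: "a (Suc k) x v = (\<Sum>z\<in>V. A x z * a k z v)" for k x
    using fin by simp
  \<comment> \<open>Closed paths of length \<open>n\<close> at \<open>v\<close> can be appended to
    any path ending at \<open>v\<close>.\<close>
  have growth: "s ^ n * a j x v \<le> a (n + j) x v" if "x \<in> V" for j x
    using that
  proof (induction j arbitrary: x)
    case 0
    then show ?case
      using n power_nonneg[OF 0 v, of n] by auto
  next
    case (Suc j)
    have "s ^ n * a (Suc j) x v = (\<Sum>z\<in>V. A x z * (s ^ n * a j z v))"
      unfolding \<open>\<And>k x. a (Suc k) x v = _\<close> sum_distrib_left by (simp add: ac_simps)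
    also have "\<dots> \<le> (\<Sum>z\<in>V. A x z * a (n + j) z v)"
      using Suc nonneg by (intro sum_mono mult_left_mono) auto
    also have "\<dots> = a (n + Suc j) x v"
      using fin by simp
    finally show ?case .
  qed
  \<comment> \<open>A window of \<open>n\<close> consecutive powers, normalised by powers of
    \<open>s\<close>. Applying \<open>A\<close> shifts the window by one; by \<open>growth\<close>
    the term that enters is at least the term that leaves, so the shift multiplies the total by at
    least \<open>s\<close>.\<close>
  define H where "H j x = (\<Sum>k<n. a (k + j) x v / s ^ k)" for j x
  have A_H: "(\<Sum>z\<in>V. A x z * H j z) = H (Suc j) x" for j x
  proof -
    have "(\<Sum>z\<in>V. A x z * H j z) = (\<Sum>k<n. \<Sum>z\<in>V. A x z * (a (k + j) z v / s ^ k))"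
      unfolding H_def sum_distrib_left by (rule sum.swap)
    also have "\<dots> = H (Suc j) x"
      unfolding H_def using fin by (simp add: sum_divide_distrib)
    finally show ?thesis .
  qed
  have H_growth: "s * H j x \<le> H (Suc j) x" if x: "x \<in> V" for j x
  proof -
    let ?g = "\<lambda>k. a (k + j) x v / s ^ k"
    have "H (Suc j) x = s * (\<Sum>k<n. ?g (Suc k))"
      unfolding H_def sum_distrib_left using s by (intro sum.cong) (auto simp del: mat_power.simps)
    moreover have "?g 0 + (\<Sum>k<n. ?g (Suc k)) = H j x + ?g n"
      unfolding H_def by (rule trans[OF sum.lessThan_Suc_shift[of ?g n, symmetric] sum.lessThan_Suc[of ?g n]])
    moreover have "?g 0 \<le> ?g n"
      using growth[OF x, of j] s by (simp add: field_simps)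
    ultimately show ?thesis
      using s by simp
  qed
  have "n \<noteq> 0"
    using n by (intro notI) simp
  have H_ge: "a j x v \<le> H j x" if x: "x \<in> V" for j x
  proof -
    have "(\<Sum>k\<in>{0}. a (k + j) x v / s ^ k) \<le> H j x"
      unfolding H_def using \<open>n \<noteq> 0\<close> s power_nonneg[OF x v] by (intro sum_mono2) auto
    then show ?thesis by simp
  qed
  \<comment> \<open>A single window may vanish at vertices from which no path to \<open>v\<close>
    has a length within it. Starting one window at \<open>j z\<close> for each vertex
    \<open>z\<close> and adding them all makes the result positive everywhere.\<close>
  obtain j where j: "\<And>x. x \<in> V \<Longrightarrow> 0 < a (j x) x v"
    using connecting_power[OF _ v] by metis
  show thesis
  proof
    fix x assume x: "x \<in> V"
    have "0 < H (j x) x"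
      using j[OF x] H_ge[OF x] by (rule less_le_trans)
    also have "\<dots> \<le> (\<Sum>z\<in>V. H (j z) x)"
      using fin x H_ge[OF x] power_nonneg[OF x v] order_trans by (intro member_le_sum) blast+
    finally show "0 < (\<Sum>z\<in>V. H (j z) x)" .
    have "s * (\<Sum>z\<in>V. H (j z) x) \<le> (\<Sum>z\<in>V. H (Suc (j z)) x)"
      unfolding sum_distrib_left by (intro sum_mono H_growth x)
    also have "\<dots> = (\<Sum>z\<in>V. \<Sum>y\<in>V. A x y * H (j z) y)"
      by (simp add: A_H)
    also have "\<dots> = (\<Sum>y\<in>V. A x y * (\<Sum>z\<in>V. H (j z) y))"
      unfolding sum_distrib_left by (rule sum.swap)
    finally show "s * (\<Sum>z\<in>V. H (j z) x) \<le> (\<Sum>y\<in>V. A x y * (\<Sum>z\<in>V. H (j z) y))" .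
  qed
qed

end

context graph_action
begin

text \<open>The common start of both indirect proofs in (iv). Both \<open>k\<close> and
  \<open>s\<close> lie strictly between the two spectral radii. The bounds \<open>m\<close> and
  \<open>M\<close> exist because the lifted function takes one value per orbit and there are
  finitely many orbits.\<close>

lemma obtain_spectral_gap:
  assumes lf: "locally_finite_graph V A" and qt: "quasi_transitive V A T"
    and neq: "spectral_radius V A \<noteq> spectral_radius orbs (reduced_matrix A)"
  obtains k s g h m M where "0 < k" "k < s"
    "\<And>x. x \<in> V \<Longrightarrow> 0 < g x"
    "\<And>x. x \<in> V \<Longrightarrow> (\<Sum>y\<in>neighbours x. A x y * g y) \<le> k * g x"
    "0 < m" "\<And>x. x \<in> V \<Longrightarrow> m \<le> h x" "\<And>x. x \<in> V \<Longrightarrow> h x \<le> M"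
    "\<And>\<tau> x. \<tau> \<in> T \<Longrightarrow> x \<in> V \<Longrightarrow> h (\<tau> x) = h x"
    "\<And>x. x \<in> V \<Longrightarrow> s * h x \<le> (\<Sum>y\<in>neighbours x. A x y * h y)"
proof -
  have fin: "finite orbs"
    using qt by (simp add: quasi_transitive_def)
  have "spectral_radius V A < spectral_radius orbs (reduced_matrix A)"
    using neq spectral_radius_le_reduced by simp
  then obtain k where k: "spectral_radius V A < ereal k" "ereal k < spectral_radius orbs (reduced_matrix A)"
    using ereal_dense2 by blast
  then obtain s where s: "ereal k < ereal s" "ereal s < spectral_radius orbs (reduced_matrix A)"
    using ereal_dense2 by blast
  have k_pos: "0 < k"
    using k spectral_radius_nonneg by (metis ereal_less(2) le_less_trans)
  obtain g where g: "\<And>x. x \<in> V \<Longrightarrow> 0 < g x"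
    "\<And>x. x \<in> V \<Longrightarrow> (\<Sum>y\<in>neighbours x. A x y * g y) \<le> k * g x"
    using obtain_superharmonic[OF lf k(1)] by blast
  obtain \<phi> where \<phi>: "\<And>X. X \<in> orbs \<Longrightarrow> 0 < \<phi> X"
    "\<And>X. X \<in> orbs \<Longrightarrow> s * \<phi> X \<le> (\<Sum>Y\<in>orbs. reduced_matrix A X Y * \<phi> Y)"
    using red.obtain_subharmonic[OF fin _ s(2)] k_pos s(1) by auto
  show thesis
  proof (rule that[where h = "\<lambda>x. \<phi> (orb x)" and m = "Min (\<phi> ` orbs)" and M = "Max (\<phi> ` orbs)", OF k_pos _ g])
    show "0 < Min (\<phi> ` orbs)"
      using fin red.nonempty \<phi>(1) by (subst Min_gr_iff) auto
  next
    fix x assume x: "x \<in> V"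
    have mem: "\<phi> (orb x) \<in> \<phi> ` orbs"
      using orb_in_orbs[OF x] by (rule imageI)
    show "Min (\<phi> ` orbs) \<le> \<phi> (orb x)" "\<phi> (orb x) \<le> Max (\<phi> ` orbs)"
      using fin mem by auto
    have bound: "0 \<le> \<phi> (orb y)" "\<phi> (orb y) \<le> Max (\<phi> ` orbs)" if "y \<in> V" for y
      using fin \<phi>(1) orb_in_orbs[OF that] by (auto intro: less_imp_le)
    have "s * \<phi> (orb x) \<le> (\<Sum>Y\<in>orbs. reduced_matrix A (orb x) Y * \<phi> Y)"
      by (rule \<phi>(2)[OF orb_in_orbs[OF x]])
    also have "\<dots> = (\<Sum>\<^sub>\<infinity>y\<in>V. A x y * \<phi> (orb y))"
      using infsumI[OF reduced_row_has_sum[OF x row_weighted_summable[OF x, of "\<lambda>y. \<phi> (orb y)", OF bound]]] fin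
      by simp
    also have "\<dots> = (\<Sum>y\<in>neighbours x. A x y * \<phi> (orb y))"
      by (rule infsum_row_eq_sum[OF lf x])
    finally show "s * \<phi> (orb x) \<le> (\<Sum>y\<in>neighbours x. A x y * \<phi> (orb y))" .
  qed (use s in \<open>auto simp: orb_T\<close>)
qed

section \<open>Condition (iv)(a)\<close>

lemma finite_row_le:
  assumes "x \<in> V" "finite L" "L \<subseteq> V"
  shows "(\<Sum>y\<in>L. A x y) \<le> C"
proof -
  have "(\<Sum>y\<in>L. A x y) \<le> (\<Sum>\<^sub>\<infinity>y\<in>V. A x y)"
    using assms by (intro finite_sum_le_infsum row_summable) (auto intro: nonneg)
  with C(2)[OF assms(1)] show ?thesis by simp
qed

text \<open>The Schur test with weight \<open>g\<close>. Symmetry of \<open>A\<close> makes the two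
  halves of the weighted square bound equal, and each is then summed row by row.\<close>

lemma superharmonic_quadratic_form_le:
  assumes lf: "locally_finite_graph V A" and sym: "symmetric_graph V A"
    and g: "\<And>x. x \<in> V \<Longrightarrow> 0 < g x"
      "\<And>x. x \<in> V \<Longrightarrow> (\<Sum>y\<in>neighbours x. A x y * g y) \<le> k * g x"
    and L: "finite L" "L \<subseteq> V"
  shows "(\<Sum>x\<in>L. \<Sum>y\<in>L. A x y * (h x * h y)) \<le> k * (\<Sum>x\<in>L. (h x)\<^sup>2)"
proof -
  define B where "B = (\<Sum>x\<in>L. \<Sum>y\<in>L. A x y * ((h x)\<^sup>2 * g y / g x))"
  \<comment> \<open>The weight \<open>g y / g x\<close> is chosen so that the sum over
    \<open>y\<close> against \<open>A x y\<close> is (A g)(x) / g(x), which is at most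
    \<open>k\<close>.\<close>
  have pointwise: "2 * (h x * h y) \<le> (h x)\<^sup>2 * g y / g x + (h y)\<^sup>2 * g x / g y"
    if "x \<in> V" "y \<in> V" for x y
  proof -
    have "0 \<le> (h x * g y - h y * g x)\<^sup>2 / (g x * g y)"
      using g(1) that by (simp add: less_imp_le)
    also have "\<dots> = (h x)\<^sup>2 * g y / g x + (h y)\<^sup>2 * g x / g y - 2 * (h x * h y)"
      using g(1)[OF that(1)] g(1)[OF that(2)] by (simp add: power2_eq_square field_simps)
    finally show ?thesis by simp
  qed
  have "2 * (\<Sum>x\<in>L. \<Sum>y\<in>L. A x y * (h x * h y)) = (\<Sum>x\<in>L. \<Sum>y\<in>L. A x y * (2 * (h x * h y)))"
    by (simp add: sum_distrib_left ac_simps)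
  also have "\<dots> \<le> (\<Sum>x\<in>L. \<Sum>y\<in>L. A x y * ((h x)\<^sup>2 * g y / g x + (h y)\<^sup>2 * g x / g y))"
    using L nonneg by (intro sum_mono mult_left_mono pointwise) auto
  also have "\<dots> = B + (\<Sum>x\<in>L. \<Sum>y\<in>L. A x y * ((h y)\<^sup>2 * g x / g y))"
    unfolding B_def by (simp add: distrib_left sum.distrib)
  also have "(\<Sum>x\<in>L. \<Sum>y\<in>L. A x y * ((h y)\<^sup>2 * g x / g y)) = (\<Sum>x\<in>L. \<Sum>y\<in>L. A y x * ((h x)\<^sup>2 * g y / g x))"
    by (rule sum.swap)
  also have "\<dots> = B"
    unfolding B_def using sym L by (intro sum.cong refl) (auto simp: symmetric_graph_def)
  finally have "(\<Sum>x\<in>L. \<Sum>y\<in>L. A x y * (h x * h y)) \<le> B"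
    by simp
  also have "B \<le> (\<Sum>x\<in>L. k * (h x)\<^sup>2)"
    unfolding B_def
  proof (rule sum_mono)
    fix x assume "x \<in> L"
    then have x: "x \<in> V" using L by blast
    have "(\<Sum>y\<in>L. A x y * g y) = (\<Sum>y\<in>L \<inter> neighbours x. A x y * g y)"
      using L x nonneg by (intro sum.mono_neutral_right) (auto simp: less_le)
    also have "\<dots> \<le> (\<Sum>y\<in>neighbours x. A x y * g y)"
      using lf x g(1) by (intro sum_mono2) (auto simp: locally_finite_graph_def less_imp_le)
    also have "\<dots> \<le> k * g x"
      by (rule g(2)[OF x])
    finally have "(h x)\<^sup>2 / g x * (\<Sum>y\<in>L. A x y * g y) \<le> (h x)\<^sup>2 / g x * (k * g x)"
      using g(1)[OF x] by (intro mult_left_mono) auto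
    also have "\<dots> = k * (h x)\<^sup>2"
      using g(1)[OF x] by simp
    also have "(h x)\<^sup>2 / g x * (\<Sum>y\<in>L. A x y * g y) = (\<Sum>y\<in>L. A x y * ((h x)\<^sup>2 * g y / g x))"
      unfolding sum_distrib_left by (intro sum.cong) (auto simp: ac_simps)
    finally show "(\<Sum>y\<in>L. A x y * ((h x)\<^sup>2 * g y / g x)) \<le> k * (h x)\<^sup>2" .
  qed
  finally show ?thesis
    by (simp add: sum_distrib_left)
qed

lemma finite_outer_boundary:
  assumes "locally_finite_graph V A" "finite L" "L \<subseteq> V"
  shows "finite (outer_boundary V A L)"
proof (rule finite_subset)
  show "outer_boundary V A L \<subseteq> (\<Union>x\<in>L. neighbours x)"
    by (auto simp: outer_boundary_def)
qed (use assms in \<open>auto simp: locally_finite_graph_def\<close>)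

lemma spectral_radius_eq_if_not_isoperimetric:
  assumes lf: "locally_finite_graph V A" and sym: "symmetric_graph V A"
    and qt: "quasi_transitive V A T"
    and inf: "(INF L\<in>{L. L \<subseteq> V \<and> finite L \<and> L \<noteq> {}}.
      real (card (outer_boundary V A L)) / real (card L)) = 0"
  shows "spectral_radius V A = spectral_radius orbs (reduced_matrix A)"
proof (rule ccontr)
  assume "\<not> ?thesis"
  then obtain k s g h m M where k: "0 < k" "k < s"
    and g: "\<And>x. x \<in> V \<Longrightarrow> 0 < g x"
      "\<And>x. x \<in> V \<Longrightarrow> (\<Sum>y\<in>neighbours x. A x y * g y) \<le> k * g x"
    and m: "0 < m" "\<And>x. x \<in> V \<Longrightarrow> m \<le> h x" "\<And>x. x \<in> V \<Longrightarrow> h x \<le> M"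
    and h: "\<And>x. x \<in> V \<Longrightarrow> s * h x \<le> (\<Sum>y\<in>neighbours x. A x y * h y)"
    by (rule obtain_spectral_gap[OF lf qt]) blast
  have h_pos: "0 < h x" if "x \<in> V" for x
    using m(1) m(2)[OF that] by linarith
  \<comment> \<open>Read off from the final comparison (s - k) m^2 |L| <= M^2 (C + 1) |boundary|.
    The summand 1 keeps the denominator positive even if \<open>C\<close> is 0.\<close>
  define c where "c = (s - k) * m\<^sup>2 / (M\<^sup>2 * (C + 1))"
  obtain v where "v \<in> V" using nonempty by blast
  then have "0 < M"
    using h_pos m(3) less_le_trans by blast
  then have c_pos: "0 < c"
    unfolding c_def using k m(1) C(1) by simp
  have "c \<le> real (card (outer_boundary V A L)) / real (card L)"
    if L: "L \<subseteq> V" "finite L" "L \<noteq> {}" for L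
  proof -
    define S where "S = (\<Sum>x\<in>L. (h x)\<^sup>2)"
    let ?D = "outer_boundary V A L"
    note D = finite_outer_boundary[OF lf L(2,1)]
    have DV: "?D \<subseteq> V"
      by (auto simp: outer_boundary_def)
    \<comment> \<open>A neighbour of a vertex of \<open>L\<close> lies in \<open>L\<close> or in its
      boundary. The boundary terms are written with \<open>A y x\<close>: after exchanging sums each
      boundary vertex contributes part of its own row, at most \<open>C\<close>.\<close>
    have row: "s * (h x)\<^sup>2 \<le> (\<Sum>y\<in>L. A x y * (h x * h y)) + (\<Sum>y\<in>?D. M\<^sup>2 * A y x)" if "x \<in> L" for x
    proof -
      have x: "x \<in> V" using that L by blast
      have "s * (h x)\<^sup>2 \<le> h x * (\<Sum>y\<in>neighbours x. A x y * h y)"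
        using mult_left_mono[OF h[OF x], of "h x"] h_pos[OF x]
        by (simp add: power2_eq_square ac_simps)
      also have "\<dots> = (\<Sum>y\<in>neighbours x. A x y * (h x * h y))"
        by (simp add: sum_distrib_left ac_simps)
      also have "\<dots> \<le> (\<Sum>y\<in>L \<union> ?D. A x y * (h x * h y))"
      proof (rule sum_mono2)
        show "neighbours x \<subseteq> L \<union> ?D"
          using \<open>x \<in> L\<close> by (auto simp: outer_boundary_def)
        show "0 \<le> A x y * (h x * h y)" if "y \<in> L \<union> ?D - neighbours x" for y
        proof -
          have "y \<in> V"
            using that L DV by blast
          then show ?thesis
            using x by (intro mult_nonneg_nonneg nonneg less_imp_le[OF h_pos])
        qed
      qed (use L D in auto)
      also have "\<dots> = (\<Sum>y\<in>L. A x y * (h x * h y)) + (\<Sum>y\<in>?D. A x y * (h x * h y))"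
        using L D by (intro sum.union_disjoint) (auto simp: outer_boundary_def)
      also have "(\<Sum>y\<in>?D. A x y * (h x * h y)) \<le> (\<Sum>y\<in>?D. M\<^sup>2 * A y x)"
      proof (rule sum_mono)
        fix y assume "y \<in> ?D"
        then have y: "y \<in> V" using DV by blast
        have "A x y * (h x * h y) \<le> A x y * (M * M)"
          using x y m(3) h_pos \<open>0 < M\<close>
          by (intro mult_left_mono mult_mono nonneg less_imp_le[OF h_pos]) simp_all
        also have "A x y = A y x"
          using sym x y by (auto simp: symmetric_graph_def)
        finally show "A x y * (h x * h y) \<le> M\<^sup>2 * A y x"
          using \<open>A x y = A y x\<close> by (simp add: power2_eq_square ac_simps)
      qed
      finally show ?thesis by simp
    qed
    have "s * S \<le> (\<Sum>x\<in>L. \<Sum>y\<in>L. A x y * (h x * h y)) + (\<Sum>x\<in>L. \<Sum>y\<in>?D. M\<^sup>2 * A y x)"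
      unfolding S_def sum_distrib_left sum.distrib[symmetric] by (rule sum_mono) (rule row)
    also have "\<dots> \<le> k * S + (\<Sum>x\<in>L. \<Sum>y\<in>?D. M\<^sup>2 * A y x)"
      unfolding S_def using superharmonic_quadratic_form_le[OF lf sym g L(2,1)] by simp
    also have "(\<Sum>x\<in>L. \<Sum>y\<in>?D. M\<^sup>2 * A y x) = (\<Sum>y\<in>?D. M\<^sup>2 * (\<Sum>x\<in>L. A y x))"
      unfolding sum_distrib_left by (rule sum.swap)
    also have "\<dots> \<le> (\<Sum>y\<in>?D. M\<^sup>2 * (C + 1))"
    proof (rule sum_mono, rule mult_left_mono)
      fix y assume "y \<in> ?D"
      then show "(\<Sum>x\<in>L. A y x) \<le> C + 1"
        using finite_row_le[of y L] L DV by force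
    qed auto
    finally have "(s - k) * S \<le> M\<^sup>2 * (C + 1) * real (card ?D)"
      by (simp add: algebra_simps)
    moreover have "m\<^sup>2 * real (card L) \<le> S"
    proof -
      have "(\<Sum>x\<in>L. m\<^sup>2) \<le> S"
        unfolding S_def using m L by (intro sum_mono power_mono) auto
      then show ?thesis by (simp add: ac_simps)
    qed
    then have "(s - k) * (m\<^sup>2 * real (card L)) \<le> (s - k) * S"
      using k by (intro mult_left_mono) auto
    ultimately have "(s - k) * m\<^sup>2 * real (card L) \<le> M\<^sup>2 * (C + 1) * real (card ?D)"
      by (simp add: mult.assoc)
    moreover have "p / q \<le> d / l" if "p * l \<le> q * d" "0 < q" "0 < l" for p q d l :: real
      using that by (simp add: field_simps)
    ultimately show ?thesis
      unfolding c_def using \<open>0 < M\<close> C(1) L by (simp add: card_gt_0_iff)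
  qed
  then have "c \<le> (INF L\<in>{L. L \<subseteq> V \<and> finite L \<and> L \<noteq> {}}.
      real (card (outer_boundary V A L)) / real (card L))"
    using \<open>v \<in> V\<close> by (intro cINF_greatest) auto
  with inf c_pos show False by simp
qed

end

section \<open>Haar measures on automorphism groups and mass transport\<close>

context graph_action
begin

abbreviation X :: "('a \<Rightarrow> 'a) topology" where
  "X \<equiv> pointwise_topology V T"

abbreviation transporter :: "'a \<Rightarrow> 'a \<Rightarrow> ('a \<Rightarrow> 'a) set" where
  "transporter x y \<equiv> {\<tau> \<in> T. \<tau> x = y}"

lemma power_T:
  assumes "\<tau> \<in> T" "x \<in> V" "y \<in> V"
  shows "a n (\<tau> x) (\<tau> y) = a n x y"
  using assms(2)
proof (induction n arbitrary: x)
  case 0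
  then show ?case
    using inj_onD[OF T_inj[OF assms(1)]] assms(3) by auto
next
  case (Suc n)
  have "a (Suc n) (\<tau> x) (\<tau> y) = (\<Sum>\<^sub>\<infinity>z\<in>V. A (\<tau> x) (\<tau> z) * a n (\<tau> z) (\<tau> y))"
    by (simp add: infsum_reindex_bij_betw[OF T_bij[OF assms(1)], of "\<lambda>z. A (\<tau> x) z * a n z (\<tau> y)"])
  also have "\<dots> = a (Suc n) x y"
    using Suc assms by (simp add: T_A cong: infsum_cong)
  finally show ?case .
qed

lemma T_PiE: "T \<subseteq> (\<Pi>\<^sub>E i\<in>V. V)"
  using T_V T_Bij by (auto simp: PiE_def Bij_def)

lemma topspace_X: "topspace X = T"
  using T_PiE by (auto simp: pointwise_topology_def)

lemma openin_transporter: "x \<in> V \<Longrightarrow> openin X (transporter x y)"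
proof -
  assume x: "x \<in> V"
  have "continuous_map X (discrete_topology V) (\<lambda>\<tau>. \<tau> x)"
    unfolding pointwise_topology_def using x
    by (intro continuous_map_from_subtopology continuous_map_product_projection)
  then have "openin X {\<tau> \<in> topspace X. \<tau> x \<in> {y} \<inter> V}"
    by (rule openin_continuous_map_preimage) simp
  moreover have "{\<tau> \<in> topspace X. \<tau> x \<in> {y} \<inter> V} = transporter x y"
    using x by (auto simp: topspace_X T_V)
  ultimately show ?thesis by simp
qed

text \<open>At the identity this says that pointwise stabilizers of finite sets form a neighbourhood
  base, which is how local compactness becomes a statement about finitely many vertices.\<close>

lemma openin_X_obtain_finite:
  assumes "openin X U" "\<sigma> \<in> U"
  obtains F where "finite F" "F \<subseteq> V" "{\<tau> \<in> T. \<forall>v\<in>F. \<tau> v = \<sigma> v} \<subseteq> U"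
proof -
  obtain S where S: "openin (product_topology (\<lambda>_. discrete_topology V) V) S" "U = S \<inter> T"
    using assms(1) by (auto simp: pointwise_topology_def openin_subtopology)
  then obtain B where B: "finite {i \<in> V. B i \<noteq> V}" "\<sigma> \<in> Pi\<^sub>E V B" "Pi\<^sub>E V B \<subseteq> S"
    using assms(2) by (auto simp: openin_product_topology_alt)
  show thesis
  proof
    show "{\<tau> \<in> T. \<forall>v\<in>{i \<in> V. B i \<noteq> V}. \<tau> v = \<sigma> v} \<subseteq> U"
    proof safe
      fix \<tau> assume \<tau>: "\<tau> \<in> T" "\<forall>v\<in>{i \<in> V. B i \<noteq> V}. \<tau> v = \<sigma> v"
      have "\<tau> \<in> Pi\<^sub>E V B"
      proof (rule PiE_I)
        fix i assume i: "i \<in> V"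
        show "\<tau> i \<in> B i"
          using \<tau> i B(2) T_V[OF \<tau>(1) i] by (cases "B i = V") auto
      next
        show "\<tau> i = undefined" if "i \<notin> V" for i
          using T_Bij[OF \<tau>(1)] that by (auto simp: Bij_def extensional_def)
      qed
      then show "\<tau> \<in> U"
        using B(3) S(2) \<tau>(1) by blast
    qed
  qed (use B in auto)
qed

lemma openin_agree:
  assumes "finite F" "F \<subseteq> V"
  shows "openin X {\<tau> \<in> T. \<forall>v\<in>F. \<tau> v = \<sigma> v}"
  using assms
proof (induction F)
  case empty
  then show ?case
    using openin_topspace[of X] by (simp add: topspace_X)
next
  case (insert u F)
  have "{\<tau> \<in> T. \<forall>v\<in>insert u F. \<tau> v = \<sigma> v} = transporter u (\<sigma> u) \<inter> {\<tau> \<in> T. \<forall>v\<in>F. \<tau> v = \<sigma> v}"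
    by auto
  then show ?case
    using insert by (simp add: openin_Int openin_transporter)
qed

lemma Hausdorff_X: "Hausdorff_space X"
  unfolding pointwise_topology_def
  by (intro Hausdorff_space_subtopology) (simp add: Hausdorff_space_product_topology)

text \<open>Left translation acts on the values of the group elements, right translation on their
  arguments. Accordingly left invariance of a measure moves the target of a transporter and right
  invariance moves its source.\<close>

lemma left_translate_agree:
  assumes \<sigma>: "\<sigma> \<in> T" and F: "F \<subseteq> V" "\<And>v. v \<in> F \<Longrightarrow> \<phi> v \<in> V"
  shows "(\<lambda>\<tau>. \<sigma> \<otimes>\<^bsub>acting_group V A T\<^esub> \<tau>) ` {\<tau> \<in> T. \<forall>v\<in>F. \<tau> v = \<phi> v} = {\<tau> \<in> T. \<forall>v\<in>F. \<tau> v = \<sigma> (\<phi> v)}"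
    (is "?l ` ?A = ?B")
proof
  show "?l ` ?A \<subseteq> ?B"
  proof
    fix \<rho> assume "\<rho> \<in> ?l ` ?A"
    then obtain \<tau> where \<tau>: "\<tau> \<in> ?A" "\<rho> = compose V \<sigma> \<tau>"
      using T_mult[OF \<sigma>] by auto
    then show "\<rho> \<in> ?B"
      using \<sigma> F(1) by (auto simp: T_compose compose_eq subset_iff)
  qed
  show "?B \<subseteq> ?l ` ?A"
  proof
    fix \<tau> assume \<tau>: "\<tau> \<in> ?B"
    let ?\<rho> = "compose V (inverse_of \<sigma>) \<tau>"
    have \<rho>: "?\<rho> \<in> T"
      using \<tau> \<sigma> T_inverse T_compose by blast
    have ext: "\<tau> \<in> extensional V"
      using \<tau> T_Bij by (auto simp: Bij_def)
    have "?\<rho> v = \<phi> v" if "v \<in> F" for v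
    proof -
      have "v \<in> V" "\<tau> v = \<sigma> (\<phi> v)" "\<sigma> (\<phi> v) \<in> V"
        using that \<tau> F T_V[OF \<sigma>] by auto
      then show ?thesis
        using inv_into_T[OF \<sigma> F(2)[OF that]] by (simp add: compose_eq)
    qed
    then have "?\<rho> \<in> ?A"
      using \<rho> by blast
    moreover have "?l ?\<rho> = \<tau>"
    proof -
      have "compose V \<sigma> ?\<rho> v = \<tau> v" if "v \<in> V" for v
        using that \<tau> \<sigma> T_V[of \<tau> v] by (simp add: compose_eq T_inv_into)
      then have "compose V \<sigma> ?\<rho> = \<tau>"
        using ext by (intro extensionalityI[of _ V]) auto
      then show ?thesis
        using T_mult[OF \<sigma> \<rho>] by simp
    qed
    ultimately show "\<tau> \<in> ?l ` ?A"
      unfolding image_iff by (intro bexI[of _ ?\<rho>]) (erule sym, assumption)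
  qed
qed

lemma right_translate_transporter:
  assumes \<sigma>: "\<sigma> \<in> T" and x: "x \<in> V"
  shows "(\<lambda>\<tau>. \<tau> \<otimes>\<^bsub>acting_group V A T\<^esub> \<sigma>) ` transporter (\<sigma> x) y = transporter x y"
    (is "?r ` ?A = ?B")
proof
  show "?r ` ?A \<subseteq> ?B"
    using T_mult[OF _ \<sigma>] T_compose[OF _ \<sigma>] x by (auto simp: compose_eq)
  show "?B \<subseteq> ?r ` ?A"
  proof
    fix \<tau> assume \<tau>: "\<tau> \<in> ?B"
    let ?\<rho> = "compose V \<tau> (inverse_of \<sigma>)"
    have \<rho>: "?\<rho> \<in> T"
      using \<tau> \<sigma> T_inverse T_compose by blast
    have ext: "\<tau> \<in> extensional V"
      using \<tau> T_Bij by (auto simp: Bij_def)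
    have "?\<rho> \<in> ?A"
      using \<rho> \<tau> x T_V[OF \<sigma> x] by (simp add: compose_eq inv_into_T[OF \<sigma> x])
    moreover have "?r ?\<rho> = \<tau>"
    proof -
      have "compose V ?\<rho> \<sigma> v = \<tau> v" if "v \<in> V" for v
        using that T_V[OF \<sigma> that] by (simp add: compose_eq inv_into_T[OF \<sigma> that])
      then have "compose V ?\<rho> \<sigma> = \<tau>"
        using ext by (intro extensionalityI[of _ V]) auto
      then show ?thesis
        using T_mult[OF \<rho> \<sigma>] by simp
    qed
    ultimately show "\<tau> \<in> ?r ` ?A"
      unfolding image_iff by (intro bexI[of _ ?\<rho>]) (erule sym, assumption)
  qed
qed

section \<open>Haar measure of transporters\<close>

context
  fixes \<mu> assumes haar: "haar_measure (acting_group V A T) X \<mu>"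
begin

lemma sets_haar: "sets \<mu> = sigma_sets T {U. openin X U}"
proof -
  have "sets \<mu> = sets (sigma (topspace X) {U. openin X U})"
    using haar by (simp add: haar_measure_def)
  also have "\<dots> = sigma_sets (topspace X) {U. openin X U}"
    by (rule sets_measure_of) (auto dest: openin_subset)
  finally show ?thesis by (simp add: topspace_X)
qed

lemma space_haar: "space \<mu> = T"
proof -
  have "sets \<mu> = sets (sigma T {U. openin X U})"
    using haar by (simp add: haar_measure_def topspace_X)
  then have "space \<mu> = space (sigma T {U. openin X U})"
    by (rule sets_eq_imp_space_eq)
  also have "\<dots> = T"
    using openin_subset[of X] by (intro space_measure_of) (auto simp: topspace_X)
  finally show ?thesis .
qed

lemma open_in_sets: "openin X U \<Longrightarrow> U \<in> sets \<mu>"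
  unfolding sets_haar by (rule sigma_sets.Basic) simp

lemma compact_in_sets: "compactin X K \<Longrightarrow> K \<in> sets \<mu>"
proof -
  assume "compactin X K"
  then have "closedin X K"
    by (rule compactin_imp_closedin[OF Hausdorff_X])
  then have "K \<subseteq> T" "openin X (T - K)"
    by (auto simp: closedin_def topspace_X)
  then have "space \<mu> - (T - K) \<in> sets \<mu>" "space \<mu> - (T - K) = K"
    using open_in_sets space_haar by auto
  then show "K \<in> sets \<mu>" by simp
qed

lemma emeasure_left_translate:
  assumes "\<sigma> \<in> T" "B \<in> sets \<mu>"
  shows "emeasure \<mu> ((\<lambda>\<tau>. \<sigma> \<otimes>\<^bsub>acting_group V A T\<^esub> \<tau>) ` B) = emeasure \<mu> B"
  using haar assms unfolding haar_measure_def by simp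

lemma emeasure_agree_translate:
  assumes "\<sigma> \<in> T" "finite F" "F \<subseteq> V" "\<And>v. v \<in> F \<Longrightarrow> \<phi> v \<in> V"
  shows "emeasure \<mu> {\<tau> \<in> T. \<forall>v\<in>F. \<tau> v = \<sigma> (\<phi> v)} = emeasure \<mu> {\<tau> \<in> T. \<forall>v\<in>F. \<tau> v = \<phi> v}"
  using emeasure_left_translate[OF assms(1) open_in_sets[OF openin_agree[OF assms(2,3)]], of \<phi>]
    left_translate_agree[OF assms(1,3,4)] by simp

lemma emeasure_transporter_left:
  assumes "\<sigma> \<in> T" "x \<in> V" "y \<in> V"
  shows "emeasure \<mu> (transporter x (\<sigma> y)) = emeasure \<mu> (transporter x y)"
  using emeasure_agree_translate[OF assms(1), of "{x}" "\<lambda>_. y"] assms by simp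

lemma emeasure_stabilizer_pos:
  assumes "x \<in> V"
  shows "0 < emeasure \<mu> (transporter x x)"
proof -
  have "restrict (\<lambda>x. x) V \<in> transporter x x"
    using T_id assms by simp
  moreover have "\<forall>U. openin X U \<and> U \<noteq> {} \<longrightarrow> 0 < emeasure \<mu> U"
    using haar unfolding haar_measure_def by (elim conjE) assumption
  ultimately show ?thesis
    using openin_transporter[OF assms] by blast
qed

text \<open>
  Local compactness makes the pointwise stabilizer of some finite set \<open>F\<close> have finite measure,
  and the stabilizer of \<open>x\<close> moves \<open>F\<close> in finitely many ways, so finitely many translates cover it.
\<close>

lemma emeasure_stabilizer_finite:
  assumes lf: "locally_finite_graph V A" and x: "x \<in> V"
  shows "emeasure \<mu> (transporter x x) < \<infinity>"
proof -
  let ?e = "restrict (\<lambda>x. x) V"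
  have "locally_compact_space X"
    using haar by (simp add: haar_measure_def)
  then obtain U K where U: "openin X U" "compactin X K" "?e \<in> U" "U \<subseteq> K"
    using T_id unfolding locally_compact_space_def topspace_X by blast
  obtain F where F: "finite F" "F \<subseteq> V" "{\<tau> \<in> T. \<forall>v\<in>F. \<tau> v = ?e v} \<subseteq> U"
    using openin_X_obtain_finite[OF U(1,3)] by blast
  define P where "P \<phi> = {\<tau> \<in> T. \<forall>v\<in>F. \<tau> v = \<phi> v}" for \<phi> :: "'a \<Rightarrow> 'a"
  have P_sets: "P \<phi> \<in> sets \<mu>" for \<phi>
    unfolding P_def by (intro open_in_sets openin_agree F)
  have "emeasure \<mu> (P ?e) \<le> emeasure \<mu> K"
    using F(3) U(4) compact_in_sets[OF U(2)] by (intro emeasure_mono) (auto simp: P_def)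
  also have "\<dots> < \<infinity>"
    using haar U(2) by (simp add: haar_measure_def)
  finally have P_finite: "emeasure \<mu> (P ?e) < \<infinity>" .
  have P_translate: "emeasure \<mu> (P \<sigma>) = emeasure \<mu> (P ?e)" if "\<sigma> \<in> T" for \<sigma>
  proof -
    have "P (\<lambda>v. \<sigma> (?e v)) = P \<sigma>"
      unfolding P_def using F(2) by auto
    moreover have "?e v \<in> V" if "v \<in> F" for v
      using that F(2) by auto
    ultimately show ?thesis
      using emeasure_agree_translate[OF that F(1,2), of ?e] unfolding P_def by metis
  qed
  define R where "R = (\<lambda>\<tau>. restrict \<tau> F) ` transporter x x"
  \<comment> \<open>An element fixing \<open>x\<close> sends \<open>v\<close> to another endpoint of
    a path of \<open>n v\<close> steps from \<open>x\<close>, and local finiteness leaves finitely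
    many of those.\<close>
  have "\<forall>v\<in>F. \<exists>n. 0 < a n x v"
    using connecting_power[OF x] F(2) by blast
  then obtain n where n: "\<And>v. v \<in> F \<Longrightarrow> 0 < a (n v) x v"
    by metis
  have "R \<subseteq> (\<Pi>\<^sub>E v\<in>F. {y \<in> V. 0 < a (n v) x y})"
  proof
    fix r assume "r \<in> R"
    then obtain \<tau> where \<tau>: "\<tau> \<in> T" "\<tau> x = x" "r = restrict \<tau> F"
      by (auto simp: R_def)
    have "\<tau> v \<in> {y \<in> V. 0 < a (n v) x y}" if v: "v \<in> F" for v
    proof -
      have "v \<in> V" using v F(2) by blast
      then show ?thesis
        using power_T[OF \<tau>(1) x, of v "n v"] n[OF v] \<tau> T_V by simp
    qed
    then show "r \<in> (\<Pi>\<^sub>E v\<in>F. {y \<in> V. 0 < a (n v) x y})"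
      unfolding \<tau>(3) by auto
  qed
  then have R_finite: "finite R"
    by (rule finite_subset) (intro finite_PiE F(1) finite_power_support[OF lf x])
  have "transporter x x \<subseteq> (\<Union>r\<in>R. P r)"
    by (auto simp: R_def P_def)
  then have "emeasure \<mu> (transporter x x) \<le> emeasure \<mu> (\<Union>r\<in>R. P r)"
    using R_finite P_sets by (intro emeasure_mono sets.finite_UN) auto
  also have "\<dots> \<le> (\<Sum>r\<in>R. emeasure \<mu> (P r))"
    using R_finite P_sets by (intro emeasure_subadditive_finite) auto
  also have "\<dots> = (\<Sum>r\<in>R. emeasure \<mu> (P ?e))"
  proof (rule sum.cong[OF refl])
    fix r assume "r \<in> R"
    then obtain \<tau> where \<tau>: "\<tau> \<in> T" "r = restrict \<tau> F"
      by (auto simp: R_def)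
    then have "P r = P \<tau>"
      by (auto simp: P_def)
    then show "emeasure \<mu> (P r) = emeasure \<mu> (P ?e)"
      using P_translate[OF \<tau>(1)] by simp
  qed
  also have "\<dots> < \<infinity>"
    using P_finite by (simp add: ennreal_mult_less_top of_nat_less_top)
  finally show ?thesis .
qed

section \<open>Unimodularity and mass transport\<close>

context
  assumes unimodular: "\<And>\<sigma> B. \<sigma> \<in> T \<Longrightarrow> B \<in> sets \<mu> \<Longrightarrow>
    emeasure \<mu> ((\<lambda>\<tau>. \<tau> \<otimes>\<^bsub>acting_group V A T\<^esub> \<sigma>) ` B) = emeasure \<mu> B"
    and lf: "locally_finite_graph V A" and sym: "symmetric_graph V A"
begin

lemma emeasure_transporter_right:
  assumes "\<sigma> \<in> T" "x \<in> V"
  shows "emeasure \<mu> (transporter (\<sigma> x) y) = emeasure \<mu> (transporter x y)"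
  using unimodular[OF assms(1) open_in_sets[OF openin_transporter[OF T_V[OF assms]]], of y]
    right_translate_transporter[OF assms, of y] by simp

text \<open>\<open>transporter x z\<close> is a left coset of the stabilizer of \<open>x\<close> and
  \<open>transporter z x\<close> a right coset. The first equality is left invariance; the second is
  where unimodularity enters.\<close>

lemma emeasure_transporter:
  assumes "x \<in> V" "z \<in> orb x"
  shows "emeasure \<mu> (transporter x z) = emeasure \<mu> (transporter x x)"
    "emeasure \<mu> (transporter z x) = emeasure \<mu> (transporter x x)"
  using assms emeasure_transporter_left[OF _ assms(1,1)] emeasure_transporter_right[OF _ assms(1)]
  by (auto simp: orb_eq)

text \<open>One function on the group is integrated in two ways, splitting the group by the image of
  \<open>y\<close> or by the preimage of \<open>x\<close>. The pieces are transporters, whose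
  measures are those of the stabilizers of \<open>y\<close> and of \<open>x\<close>
  respectively.\<close>

lemma mass_transport:
  assumes x: "x \<in> V" and y: "y \<in> V"
    and F: "\<And>\<tau> u v. \<tau> \<in> T \<Longrightarrow> u \<in> V \<Longrightarrow> v \<in> V \<Longrightarrow> F (\<tau> u) (\<tau> v) = (F u v :: real)"
  shows "measure \<mu> (transporter y y) * (\<Sum>z\<in>neighbours x \<inter> orb y. F x z) =
    measure \<mu> (transporter x x) * (\<Sum>z\<in>neighbours y \<inter> orb x. F z y)"
proof -
  have fin: "finite (neighbours u \<inter> W)" if "u \<in> V" for u W
    using lf that by (simp add: locally_finite_graph_def)
  \<comment> \<open>The mass sent from \<open>x\<close> to the image of \<open>y\<close>, counted
    only along edges so that finitely many pieces contribute.\<close>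
  define f where "f \<tau> = (if \<tau> y \<in> neighbours x then F x (\<tau> y) else 0)" for \<tau>
  have f1: "f \<tau> = (\<Sum>z\<in>neighbours x \<inter> orb y. F x z * indicator (transporter y z) \<tau>)"
    if \<tau>: "\<tau> \<in> space \<mu>" for \<tau>
  proof -
    have "\<tau> \<in> T" using \<tau> by (simp add: space_haar)
    then have "(\<Sum>z\<in>neighbours x \<inter> orb y. F x z * indicator (transporter y z) \<tau>) =
        (\<Sum>z\<in>neighbours x \<inter> orb y. if \<tau> y = z then F x z else 0)"
      by (intro sum.cong) (auto simp: indicator_def)
    also have "\<dots> = (if \<tau> y \<in> neighbours x \<inter> orb y then F x (\<tau> y) else 0)"
      by (rule sum.delta'[OF fin[OF x]])
    also have "\<dots> = f \<tau>"
      using \<open>\<tau> \<in> T\<close> by (auto simp: f_def orb_eq)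
    finally show ?thesis by simp
  qed
  \<comment> \<open>With \<open>u\<close> the preimage of \<open>x\<close>, invariance rewrites
    \<open>F x (\<tau> y)\<close> as \<open>F u y\<close>; symmetry of \<open>A\<close> turns the
    edge condition at \<open>x\<close> into one at \<open>y\<close>.\<close>
  have f2: "f \<tau> = (\<Sum>z\<in>neighbours y \<inter> orb x. F z y * indicator (transporter z x) \<tau>)"
    if \<tau>: "\<tau> \<in> space \<mu>" for \<tau>
  proof -
    have T: "\<tau> \<in> T" using \<tau> by (simp add: space_haar)
    define u where "u = inv_into V \<tau> x"
    have u: "u \<in> V" "\<tau> u = x" "u \<in> orb x"
      using T x orb_T[OF T, of u] orb_self[of u] by (auto simp: u_def inv_into_V T_inv_into)
    have "(\<Sum>z\<in>neighbours y \<inter> orb x. F z y * indicator (transporter z x) \<tau>) =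
        (\<Sum>z\<in>neighbours y \<inter> orb x. if u = z then F z y else 0)"
    proof (rule sum.cong[OF refl])
      fix z assume "z \<in> neighbours y \<inter> orb x"
      then show "F z y * indicator (transporter z x) \<tau> = (if u = z then F z y else 0)"
        using T x inv_into_eq_iff[OF T _ x, of z] by (auto simp: u_def indicator_def)
    qed
    also have "\<dots> = (if u \<in> neighbours y \<inter> orb x then F u y else 0)"
      by (rule sum.delta'[OF fin[OF y]])
    also have "\<dots> = f \<tau>"
    proof -
      have "A y u = A x (\<tau> y)"
        using T_A[OF T y u(1)] sym x y u T_V[OF T y] by (simp add: symmetric_graph_def)
      moreover have "F u y = F x (\<tau> y)"
        using F[OF T u(1) y] u(2) by simp
      ultimately show ?thesis
        using u T_V[OF T y] by (auto simp: f_def)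
    qed
    finally show ?thesis by simp
  qed
  have transporter_integral: "has_bochner_integral \<mu> (\<lambda>\<tau>. c * indicator (transporter u v) \<tau>)
      (c * measure \<mu> (transporter w w))"
    if "w \<in> V" "u \<in> V" "emeasure \<mu> (transporter u v) = emeasure \<mu> (transporter w w)" for c u v w
  proof -
    have "measure \<mu> (transporter u v) = measure \<mu> (transporter w w)"
      using that(3) by (simp add: measure_def)
    moreover have "has_bochner_integral \<mu> (indicator (transporter u v)) (measure \<mu> (transporter u v))"
      using that emeasure_stabilizer_finite[OF lf that(1)]
      by (intro has_bochner_integral_real_indicator open_in_sets openin_transporter) auto
    ultimately show ?thesis
      by (intro has_bochner_integral_mult_right) simp
  qed
  have "has_bochner_integral \<mu> f (\<Sum>z\<in>neighbours x \<inter> orb y. F x z * measure \<mu> (transporter y y))"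
    by (subst has_bochner_integral_cong[OF refl f1 refl], assumption,
        rule has_bochner_integral_sum, rule transporter_integral)
      (use y emeasure_transporter(1)[OF y] in auto)
  moreover have "has_bochner_integral \<mu> f (\<Sum>z\<in>neighbours y \<inter> orb x. F z y * measure \<mu> (transporter x x))"
    by (subst has_bochner_integral_cong[OF refl f2 refl], assumption,
        rule has_bochner_integral_sum, rule transporter_integral)
      (use x emeasure_transporter(2)[OF x] in auto)
  ultimately have "(\<Sum>z\<in>neighbours x \<inter> orb y. F x z * measure \<mu> (transporter y y)) =
      (\<Sum>z\<in>neighbours y \<inter> orb x. F z y * measure \<mu> (transporter x x))"
    by (rule has_bochner_integral_eq)
  then show ?thesis
    by (simp add: sum_distrib_left ac_simps)
qed

text \<open>The flow \<open>G Y Z / w Y\<close> between orbits, with the stabilizer measures as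
  weights, is antisymmetric by \<open>mass_transport\<close>. Its finite double sum therefore equals
  its own negative.\<close>

lemma antisymmetric_transport_sum_zero:
  assumes qt: "quasi_transitive V A T"
    and F: "\<And>\<tau> u v. \<tau> \<in> T \<Longrightarrow> u \<in> V \<Longrightarrow> v \<in> V \<Longrightarrow> F (\<tau> u) (\<tau> v) = (F u v :: real)"
    and anti: "\<And>u v. u \<in> V \<Longrightarrow> v \<in> neighbours u \<Longrightarrow> F v u = - F u v"
    and rep: "\<And>Y. Y \<in> orbs \<Longrightarrow> r Y \<in> Y"
  shows "(\<Sum>Y\<in>orbs. (\<Sum>z\<in>neighbours (r Y). F (r Y) z) / measure \<mu> (transporter (r Y) (r Y))) = 0"
    (is "?S = 0")
proof -
  have fin: "finite orbs"
    using qt by (simp add: quasi_transitive_def)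
  define w where "w Y = measure \<mu> (transporter (r Y) (r Y))" for Y
  define G where "G Y Z = (\<Sum>z\<in>neighbours (r Y) \<inter> Z. F (r Y) z)" for Y Z
  have r: "r Y \<in> V" "orb (r Y) = Y" if "Y \<in> orbs" for Y
    using mem_orbs[OF that rep[OF that]] by auto
  have w: "0 < w Y" if "Y \<in> orbs" for Y
    using emeasure_stabilizer_pos[OF r(1)[OF that]] emeasure_stabilizer_finite[OF lf r(1)[OF that]]
    by (simp add: w_def measure_def enn2real_positive_iff)
  have "?S = (\<Sum>Y\<in>orbs. \<Sum>Z\<in>orbs. G Y Z / w Y)"
  proof (rule sum.cong[OF refl])
    fix Y assume Y: "Y \<in> orbs"
    have "(\<Sum>Z\<in>orbs. \<Sum>z\<in>{z \<in> neighbours (r Y). orb z = Z}. F (r Y) z) = (\<Sum>z\<in>neighbours (r Y). F (r Y) z)"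
      using lf r(1)[OF Y] fin orb_in_orbs
      by (intro sum.group) (auto simp: locally_finite_graph_def)
    moreover have "{z \<in> neighbours (r Y). orb z = Z} = neighbours (r Y) \<inter> Z" if "Z \<in> orbs" for Z
      using mem_orbs_iff[OF that] by auto
    ultimately have "(\<Sum>z\<in>neighbours (r Y). F (r Y) z) = (\<Sum>Z\<in>orbs. G Y Z)"
      unfolding G_def by simp
    then show "(\<Sum>z\<in>neighbours (r Y). F (r Y) z) / measure \<mu> (transporter (r Y) (r Y)) = (\<Sum>Z\<in>orbs. G Y Z / w Y)"
      by (simp add: w_def sum_divide_distrib)
  qed
  moreover have "(\<Sum>Y\<in>orbs. \<Sum>Z\<in>orbs. G Y Z / w Y) = (\<Sum>Y\<in>orbs. \<Sum>Z\<in>orbs. - (G Z Y / w Z))"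
  proof (intro sum.cong refl)
    fix Y Z assume YZ: "Y \<in> orbs" "Z \<in> orbs"
    have "w Z * G Y Z = w Y * (\<Sum>z\<in>neighbours (r Z) \<inter> Y. F z (r Z))"
      using mass_transport[OF r(1)[OF YZ(1)] r(1)[OF YZ(2)], of F, OF F]
      by (simp add: w_def G_def r(2)[OF YZ(1)] r(2)[OF YZ(2)])
    also have "(\<Sum>z\<in>neighbours (r Z) \<inter> Y. F z (r Z)) = - G Z Y"
      unfolding G_def sum_negf[symmetric] using anti r(1)[OF YZ(2)] by (intro sum.cong) auto
    finally show "G Y Z / w Y = - (G Z Y / w Z)"
      using w[OF YZ(1)] w[OF YZ(2)] by (simp add: field_simps)
  qed
  moreover have "(\<Sum>Y\<in>orbs. \<Sum>Z\<in>orbs. - (G Z Y / w Z)) = - (\<Sum>Y\<in>orbs. \<Sum>Z\<in>orbs. G Y Z / w Y)"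
    unfolding sum_negf by (rule arg_cong[where f = uminus], rule sum.swap)
  ultimately show ?thesis by linarith
qed

end

end

end

section \<open>Invariant means and the amenable case\<close>

lemma ess_bounded_sum:
  assumes "\<And>i. i \<in> I \<Longrightarrow> f i \<in> ess_bounded \<mu>"
  shows "(\<lambda>h. \<Sum>i\<in>I. c i * f i h) \<in> ess_bounded \<mu>"
proof -
  have "\<exists>K. \<forall>i\<in>I. AE h in \<mu>. \<bar>f i h\<bar> \<le> K i"
    using assms by (intro bchoice) (auto simp: ess_bounded_def)
  then obtain K where K: "\<And>i. i \<in> I \<Longrightarrow> AE h in \<mu>. \<bar>f i h\<bar> \<le> K i"
    by blast
  show ?thesis
  proof (cases "finite I")
    case True
    then have "AE h in \<mu>. \<forall>i\<in>I. \<bar>f i h\<bar> \<le> K i"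
      using K by (simp add: AE_finite_all)
    then have "AE h in \<mu>. \<bar>\<Sum>i\<in>I. c i * f i h\<bar> \<le> (\<Sum>i\<in>I. \<bar>c i\<bar> * K i)"
    proof eventually_elim
      case (elim h)
      then show ?case
        by (intro order_trans[OF sum_abs] sum_mono) (auto simp: abs_mult intro: mult_left_mono)
    qed
    moreover have "(\<lambda>h. \<Sum>i\<in>I. c i * f i h) \<in> borel_measurable \<mu>"
      using assms by (intro borel_measurable_sum borel_measurable_times) (auto simp: ess_bounded_def)
    ultimately show ?thesis
      unfolding ess_bounded_def by blast
  qed (auto simp: ess_bounded_def)
qed

lemma ess_bounded_const: "(\<lambda>_. c) \<in> ess_bounded \<mu>"
  by (auto simp: ess_bounded_def)

context
  fixes G :: "('g, 'b) monoid_scheme" and \<mu> :: "'g measure" and m :: "('g \<Rightarrow> real) \<Rightarrow> real"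
  assumes mean: "left_invariant_mean G \<mu> m"
begin

lemma mean_nonneg: "f \<in> ess_bounded \<mu> \<Longrightarrow> (\<And>h. h \<in> space \<mu> \<Longrightarrow> 0 \<le> f h) \<Longrightarrow> 0 \<le> m f"
  using mean unfolding left_invariant_mean_def by (metis AE_I2)

lemma mean_add: "f \<in> ess_bounded \<mu> \<Longrightarrow> f' \<in> ess_bounded \<mu> \<Longrightarrow> m (\<lambda>h. f h + f' h) = m f + m f'"
  and mean_scale: "f \<in> ess_bounded \<mu> \<Longrightarrow> m (\<lambda>h. c * f h) = c * m f"
  and mean_translate: "g \<in> carrier G \<Longrightarrow> f \<in> ess_bounded \<mu> \<Longrightarrow> m (\<lambda>h. f (g \<otimes>\<^bsub>G\<^esub> h)) = m f"
  and mean_one: "m (\<lambda>_. 1) = 1"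
  using mean unfolding left_invariant_mean_def by blast+

lemma mean_const: "m (\<lambda>_. c) = c"
  using mean_scale[OF ess_bounded_const[of 1], of c] mean_one by simp

lemma mean_sum:
  assumes "finite I" "\<And>i. i \<in> I \<Longrightarrow> f i \<in> ess_bounded \<mu>"
  shows "m (\<lambda>h. \<Sum>i\<in>I. c i * f i h) = (\<Sum>i\<in>I. c i * m (f i))"
  using assms
proof (induction I)
  case empty
  then show ?case using mean_const[of 0] by simp
next
  case (insert j I)
  have "(\<lambda>h. c j * f j h) \<in> ess_bounded \<mu>"
    using ess_bounded_sum[of "{j}" f \<mu> c] insert by simp
  moreover have "(\<lambda>h. \<Sum>i\<in>I. c i * f i h) \<in> ess_bounded \<mu>"
    using insert by (intro ess_bounded_sum) auto
  ultimately show ?case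
    using insert by (simp add: mean_add mean_scale)
qed

lemma mean_mono:
  assumes "f \<in> ess_bounded \<mu>" "f' \<in> ess_bounded \<mu>" "\<And>h. h \<in> space \<mu> \<Longrightarrow> f h \<le> f' h"
  shows "m f \<le> m f'"
proof -
  have neg: "(\<lambda>h. (-1) * f h) \<in> ess_bounded \<mu>"
    using ess_bounded_sum[of "{()}" "\<lambda>_. f" \<mu> "\<lambda>_. -1"] assms(1) by simp
  \<comment> \<open>The difference is a linear combination indexed by the two booleans, so
    \<open>ess_bounded_sum\<close> applies.\<close>
  have "(\<lambda>h. f' h + (-1) * f h) \<in> ess_bounded \<mu>"
    using ess_bounded_sum[of UNIV "\<lambda>b. if b then f else f'" \<mu> "\<lambda>b. if b then -1 else 1"] assms(1,2)
    by (simp add: UNIV_bool)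
  then have "0 \<le> m (\<lambda>h. f' h + (-1) * f h)"
    using assms(3) by (intro mean_nonneg) auto
  then show ?thesis
    using mean_add[OF assms(2) neg] mean_scale[OF assms(1), of "-1"] by simp
qed

lemma mean_cong:
  assumes "f \<in> ess_bounded \<mu>" "f' \<in> ess_bounded \<mu>" "\<And>h. h \<in> space \<mu> \<Longrightarrow> f h = f' h"
  shows "m f = m f'"
  using assms by (intro antisym mean_mono) auto

end

text \<open>Jensen's inequality for the logarithm, with weights \<open>p y * h y\<close> and arguments \<open>h0 * g y / (h y * g0)\<close>.\<close>

lemma weighted_log_ratio_sum_le:
  fixes p h g :: "'a \<Rightarrow> real"
  assumes p: "\<And>y. y \<in> N \<Longrightarrow> 0 \<le> p y"
    and pos: "\<And>y. y \<in> N \<Longrightarrow> 0 < h y" "\<And>y. y \<in> N \<Longrightarrow> 0 < g y" "0 < h0" "0 < g0"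
    and k: "0 < k" "k < s"
    and g: "(\<Sum>y\<in>N. p y * g y) \<le> k * g0" and h: "s * h0 \<le> (\<Sum>y\<in>N. p y * h y)"
  shows "(\<Sum>y\<in>N. p y * h y * (ln h0 - ln (h y) + (ln (g y) - ln g0))) \<le> s * h0 * ln (k / s)"
proof -
  have s: "0 < s" using k by linarith
  define S where "S = (\<Sum>y\<in>N. p y * h y)"
  \<comment> \<open>Normalisation for ln t <= t - 1 at \<open>b * g y / h y\<close>: it makes
    \<open>b * k * g0\<close> equal to \<open>s * h0\<close>, so that the tangent is taken where the
    weighted mean lies when both hypotheses are equalities.\<close>
  define b where "b = h0 * s / (k * g0)"
  have b: "0 < b" using pos(3,4) k s by (simp add: b_def)
  have term_le: "p y * h y * (ln h0 - ln (h y) + (ln (g y) - ln g0)) \<le>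
      (ln (k / s) - 1) * (p y * h y) + b * (p y * g y)" if y: "y \<in> N" for y
  proof -
    have "ln (b * g y / h y) \<le> b * g y / h y - 1"
      using pos(1,2)[OF y] b by (intro ln_le_minus_one) simp
    moreover have "ln (b * g y / h y) = ln h0 - ln (h y) + (ln (g y) - ln g0) - ln (k / s)"
      using pos(1,2)[OF y] pos(3,4) k s by (simp add: b_def ln_div ln_mult)
    ultimately have "ln h0 - ln (h y) + (ln (g y) - ln g0) \<le> ln (k / s) - 1 + b * g y / h y"
      by linarith
    then have "p y * h y * (ln h0 - ln (h y) + (ln (g y) - ln g0)) \<le>
        p y * h y * (ln (k / s) - 1 + b * g y / h y)"
      using p[OF y] pos(1)[OF y] by (intro mult_left_mono) auto
    also have "\<dots> = (ln (k / s) - 1) * (p y * h y) + b * (p y * g y)"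
      using pos(1)[OF y] by (simp add: field_simps)
    finally show ?thesis .
  qed
  have "(\<Sum>y\<in>N. p y * h y * (ln h0 - ln (h y) + (ln (g y) - ln g0))) \<le>
      (ln (k / s) - 1) * S + b * (\<Sum>y\<in>N. p y * g y)"
    unfolding S_def sum_distrib_left sum.distrib[symmetric] by (rule sum_mono) (rule term_le)
  also have "b * (\<Sum>y\<in>N. p y * g y) \<le> b * (k * g0)"
    using g b by (intro mult_left_mono) auto
  also have "b * (k * g0) = s * h0"
    using pos(4) k by (simp add: b_def)
  finally have "(\<Sum>y\<in>N. p y * h y * (ln h0 - ln (h y) + (ln (g y) - ln g0))) \<le>
      (ln (k / s) - 1) * S + s * h0"
    by simp
  \<comment> \<open>The coefficient of \<open>S\<close> is negative because \<open>k < s\<close>, so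
    the lower bound on \<open>S\<close> gives an upper bound here.\<close>
  also have "\<dots> \<le> (ln (k / s) - 1) * (s * h0) + s * h0"
  proof -
    have "ln (k / s) < 0"
      using k s by (subst ln_less_zero_iff) auto
    then have "(ln (k / s) - 1) * S \<le> (ln (k / s) - 1) * (s * h0)"
      using h unfolding S_def by (intro mult_left_mono_neg) auto
    then show ?thesis by simp
  qed
  finally show ?thesis
    by (simp add: algebra_simps)
qed

section \<open>Condition (iv)(b)\<close>

context graph_action
begin

text \<open>The value depends on the group element only through two preimages, and fixing these is
  an open condition. The function is locally constant, so every preimage is a union of open
  sets.\<close>

lemma borel_measurable_inverse_eval:
  assumes haar: "haar_measure (acting_group V A T) X \<mu>" and x: "x \<in> V" and y: "y \<in> V"
  shows "(\<lambda>\<tau>. f (inv_into V \<tau> x) (inv_into V \<tau> y) :: real) \<in> borel_measurable \<mu>" (is "?f \<in> _")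
proof (rule measurableI)
  fix B :: "real set"
  have "?f -` B \<inter> space \<mu> = \<Union> {transporter u x \<inter> transporter v y | u v. u \<in> V \<and> v \<in> V \<and> f u v \<in> B}"
    (is "?L = \<Union> ?R")
  proof (intro equalityI subsetI)
    fix \<tau> assume "\<tau> \<in> ?L"
    then have \<tau>: "\<tau> \<in> space \<mu>" "?f \<tau> \<in> B" by auto
    then have T: "\<tau> \<in> T" by (simp add: space_haar[OF haar])
    let ?u = "inv_into V \<tau> x" and ?v = "inv_into V \<tau> y"
    have "transporter ?u x \<inter> transporter ?v y \<in> ?R"
      using inv_into_V[OF T] x y \<tau>(2) by blast
    moreover have "\<tau> \<in> transporter ?u x \<inter> transporter ?v y"
      using T T_inv_into x y by simp
    ultimately show "\<tau> \<in> \<Union> ?R" by blast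
  next
    fix \<tau> assume "\<tau> \<in> \<Union> ?R"
    then obtain u v where "u \<in> V" "v \<in> V" "f u v \<in> B" "\<tau> \<in> T" "\<tau> u = x" "\<tau> v = y"
      by blast
    then show "\<tau> \<in> ?L"
      using inv_into_T[of \<tau> u] inv_into_T[of \<tau> v] by (simp add: space_haar[OF haar])
  qed
  moreover have "openin X (\<Union> ?R)"
    by (intro openin_Union) (auto intro: openin_Int openin_transporter)
  ultimately show "?L \<in> sets \<mu>"
    using open_in_sets[OF haar] by simp
qed simp

lemma spectral_radius_eq_if_amenable_unimodular:
  assumes lf: "locally_finite_graph V A" and sym: "symmetric_graph V A"
    and qt: "quasi_transitive V A T"
    and am: "amenable_group (acting_group V A T) X"
    and uni: "unimodular_group (acting_group V A T) X"
  shows "spectral_radius V A = spectral_radius orbs (reduced_matrix A)"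
proof (rule ccontr)
  assume "\<not> ?thesis"
  then obtain k s g h M0 M where k: "0 < k" "k < s"
    and g: "\<And>x. x \<in> V \<Longrightarrow> 0 < g x"
      "\<And>x. x \<in> V \<Longrightarrow> (\<Sum>y\<in>neighbours x. A x y * g y) \<le> k * g x"
    and h: "0 < M0" "\<And>x. x \<in> V \<Longrightarrow> M0 \<le> h x"
      "\<And>\<tau> x. \<tau> \<in> T \<Longrightarrow> x \<in> V \<Longrightarrow> h (\<tau> x) = h x"
      "\<And>x. x \<in> V \<Longrightarrow> s * h x \<le> (\<Sum>y\<in>neighbours x. A x y * h y)"
    by (rule obtain_spectral_gap[OF lf qt]) blast
  have h_pos: "0 < h x" if "x \<in> V" for x
    using h(1) h(2)[OF that] by linarith
  \<comment> \<open>\<open>\<mu>\<close> carries the mean and the measure \<open>\<nu>\<close>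
    obtained next carries the mass transport. They need not be compared: only the function
    \<open>\<beta>\<close> passes from one argument to the other.\<close>
  obtain \<mu> m where \<mu>: "haar_measure (acting_group V A T) X \<mu>"
    and m: "left_invariant_mean (acting_group V A T) \<mu> m"
    using am unfolding amenable_group_def by blast
  obtain \<nu> where \<nu>: "haar_measure (acting_group V A T) X \<nu>"
    and right: "\<And>\<sigma> B. \<sigma> \<in> T \<Longrightarrow> B \<in> sets \<nu> \<Longrightarrow>
      emeasure \<nu> ((\<lambda>\<tau>. \<tau> \<otimes>\<^bsub>acting_group V A T\<^esub> \<sigma>) ` B) = emeasure \<nu> B"
    using uni unfolding unimodular_group_def by auto
  have nb_sym: "x \<in> neighbours y" if "x \<in> V" "y \<in> neighbours x" for x y
    using that sym by (simp add: symmetric_graph_def)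
  have fin: "finite (neighbours x)" if "x \<in> V" for x
    using lf that by (simp add: locally_finite_graph_def)

  \<comment> \<open>Evaluation at inverse images suits left invariance: the inverse of the product
    of \<open>\<sigma>\<close> and \<open>\<tau>\<close> sends \<open>\<sigma> x\<close> to the
    preimage of \<open>x\<close> under \<open>\<tau>\<close>, so translating
    \<open>f (\<sigma> x) (\<sigma> y)\<close> by \<open>\<sigma>\<close> gives back
    \<open>f x y\<close>.\<close>
  define f where "f x y \<tau> = ln (g (inv_into V \<tau> y)) - ln (g (inv_into V \<tau> x))" for x y and \<tau> :: "'a \<Rightarrow> 'a"
  define \<beta> where "\<beta> x y = m (f x y)" for x y
  \<comment> \<open>A Harnack inequality from a single term of A g <= k g. Used for both
    orientations of an edge it bounds \<open>f x y\<close> uniformly on the group.\<close>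
  have edge: "ln (g y) - ln (g x) \<le> ln (k / A x y)" if "x \<in> V" "y \<in> neighbours x" for x y
  proof -
    have "A x y * g y \<le> (\<Sum>y\<in>neighbours x. A x y * g y)"
      using that g(1) by (intro member_le_sum[OF that(2)] fin) (auto simp: less_imp_le)
    also have "\<dots> \<le> k * g x"
      by (rule g(2)[OF that(1)])
    finally have "g y / g x \<le> k / A x y"
      using that g(1) by (simp add: field_simps)
    then have "ln (g y / g x) \<le> ln (k / A x y)"
      using that g(1) k by (subst ln_le_cancel_iff) auto
    moreover have "ln (g y / g x) = ln (g y) - ln (g x)"
      using that(2) g(1)[OF that(1)] g(1)[of y] by (simp add: ln_div)
    ultimately show ?thesis by simp
  qed
  have f_bounded: "f x y \<in> ess_bounded \<mu>" if xy: "x \<in> V" "y \<in> neighbours x" for x y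
  proof -
    have yV: "y \<in> V" using xy by blast
    have "\<bar>f x y \<tau>\<bar> \<le> ln (k / A x y)" if "\<tau> \<in> space \<mu>" for \<tau>
    proof -
      have T: "\<tau> \<in> T" using that by (simp add: space_haar[OF \<mu>])
      let ?x = "inv_into V \<tau> x" and ?y = "inv_into V \<tau> y"
      have V: "?x \<in> V" "?y \<in> V"
        using inv_into_V[OF T] xy(1) yV by auto
      have "A ?x ?y = A x y"
        using T_A[OF T V] T_inv_into[OF T] xy(1) yV by simp
      moreover have "A ?y ?x = A ?x ?y"
        using sym V by (simp add: symmetric_graph_def)
      ultimately show ?thesis
        using edge[of ?x ?y] edge[of ?y ?x] V xy by (simp add: f_def abs_le_iff)
    qed
    then have "AE \<tau> in \<mu>. \<bar>f x y \<tau>\<bar> \<le> ln (k / A x y)"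
      by (rule AE_I2)
    moreover have "f x y \<in> borel_measurable \<mu>"
      unfolding f_def by (rule borel_measurable_inverse_eval[OF \<mu> xy(1) yV, of "\<lambda>u v. ln (g v) - ln (g u)"])
    ultimately show ?thesis
      unfolding ess_bounded_def by blast
  qed
  have \<beta>_anti: "\<beta> y x = - \<beta> x y" if "x \<in> V" "y \<in> neighbours x" for x y
  proof -
    have "f y x = (\<lambda>\<tau>. (-1) * f x y \<tau>)"
      by (simp add: f_def fun_eq_iff)
    then show ?thesis
      using mean_scale[OF m f_bounded[OF that], of "-1"] by (simp add: \<beta>_def)
  qed
  have \<beta>_inv: "\<beta> (\<sigma> x) (\<sigma> y) = \<beta> x y" if \<sigma>: "\<sigma> \<in> T" and xy: "x \<in> V" "y \<in> neighbours x" for \<sigma> x y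
  proof -
    have yV: "y \<in> V" using xy by blast
    have nb: "\<sigma> x \<in> V" "\<sigma> y \<in> neighbours (\<sigma> x)"
      using T_V[OF \<sigma>] T_A[OF \<sigma>] xy by auto
    \<comment> \<open>The mean is applied to functions on the whole type, whereas this translate is
      shown to agree with \<open>f x y\<close> only on \<open>T\<close>; \<open>mean_cong\<close>
      bridges the difference.\<close>
    let ?f = "\<lambda>\<tau>. f (\<sigma> x) (\<sigma> y) (\<sigma> \<otimes>\<^bsub>acting_group V A T\<^esub> \<tau>)"
    have eq: "?f \<tau> = f x y \<tau>" if "\<tau> \<in> space \<mu>" for \<tau>
    proof -
      have \<tau>: "\<tau> \<in> T" using that by (simp add: space_haar[OF \<mu>])
      have "inv_into V (compose V \<sigma> \<tau>) (\<sigma> z) = inv_into V \<tau> z" if z: "z \<in> V" for z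
        using inv_into_eq_iff[OF T_compose[OF \<sigma> \<tau>] inv_into_V[OF \<tau> z] T_V[OF \<sigma> z]] z
        by (simp add: compose_eq inv_into_V[OF \<tau>] T_inv_into[OF \<tau>])
      then show ?thesis
        using xy yV T_mult[OF \<sigma> \<tau>] by (simp add: f_def)
    qed
    have "?f \<in> ess_bounded \<mu>"
    proof -
      have "?f \<in> borel_measurable \<mu>"
        using f_bounded[OF xy] by (subst measurable_cong[OF eq]) (auto simp: ess_bounded_def)
      moreover obtain K where "AE \<tau> in \<mu>. \<bar>f x y \<tau>\<bar> \<le> K"
        using f_bounded[OF xy] by (auto simp: ess_bounded_def)
      then have "AE \<tau> in \<mu>. \<bar>?f \<tau>\<bar> \<le> K"
        using AE_space
      proof eventually_elim
        case (elim \<tau>)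
        then show ?case
          by (simp only: eq)
      qed
      ultimately show ?thesis
        unfolding ess_bounded_def by blast
    qed
    then have "m ?f = m (f x y)"
      using eq by (intro mean_cong[OF m _ f_bounded[OF xy]])
    moreover have "m ?f = m (f (\<sigma> x) (\<sigma> y))"
      using \<sigma> by (intro mean_translate[OF m _ f_bounded[OF nb]]) simp
    ultimately show ?thesis by (simp add: \<beta>_def)
  qed

  \<comment> \<open>The factor \<open>A x y\<close> removes the pairs for which no bound on
    \<open>f x y\<close> has been established, and the symmetric factor \<open>h x * h y\<close>
    leaves antisymmetry to the bracket.\<close>
  define F where "F x y = A x y * (h x * h y) * (ln (h x) - ln (h y) + \<beta> x y)" for x y
  have F_inv: "F (\<sigma> x) (\<sigma> y) = F x y" if "\<sigma> \<in> T" "x \<in> V" "y \<in> V" for \<sigma> x y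
  proof (cases "0 < A x y")
    case True
    then show ?thesis
      using that T_A h(3) \<beta>_inv by (simp add: F_def)
  next
    case False
    then have "A x y = 0" using nonneg[OF that(2,3)] by simp
    then show ?thesis using that T_A by (simp add: F_def)
  qed
  have F_anti: "F y x = - F x y" if "x \<in> V" "y \<in> neighbours x" for x y
    using that sym \<beta>_anti[OF that] by (simp add: F_def symmetric_graph_def algebra_simps)
  have F_neg: "(\<Sum>y\<in>neighbours x. F x y) < 0" if x: "x \<in> V" for x
  proof -
    let ?c = "\<lambda>y. A x y * h y"
    let ?D = "\<Sum>y\<in>neighbours x. ?c y * (ln (h x) - ln (h y))"
    \<comment> \<open>Each translate of \<open>g\<close> is again superharmonic, so Jensen applies
      for every group element with the same \<open>h\<close>. The bound does not depend on that
      element, hence survives averaging.\<close>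
    have pointwise: "(\<Sum>y\<in>neighbours x. ?c y * f x y \<tau>) \<le> s * h x * ln (k / s) - ?D"
      if "\<tau> \<in> space \<mu>" for \<tau>
    proof -
      have T: "\<tau> \<in> T" using that by (simp add: space_haar[OF \<mu>])
      let ?i = "inv_into V \<tau>"
      have nb: "bij_betw \<tau> (neighbours (?i x)) (neighbours x)"
      proof (rule bij_betw_byWitness[where f' = ?i])
        have A_i: "A (?i x) u = A x (\<tau> u)" if "u \<in> V" for u
          using T_A[OF T inv_into_V[OF T x] that] T_inv_into[OF T x] by simp
        show "\<tau> ` neighbours (?i x) \<subseteq> neighbours x"
          using A_i T_V[OF T] by auto
        show "?i ` neighbours x \<subseteq> neighbours (?i x)"
          using A_i inv_into_V[OF T] T_inv_into[OF T] by auto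
      qed (auto simp: inv_into_T[OF T] T_inv_into[OF T])
      have "(\<Sum>y\<in>neighbours x. A x y * g (?i y)) = (\<Sum>u\<in>neighbours (?i x). A x (\<tau> u) * g (?i (\<tau> u)))"
        by (rule sum.reindex_bij_betw[OF nb, symmetric])
      also have "\<dots> = (\<Sum>u\<in>neighbours (?i x). A (?i x) u * g u)"
        using T_A[OF T inv_into_V[OF T x]] T_inv_into[OF T x] inv_into_T[OF T]
        by (intro sum.cong refl) auto
      also have "\<dots> \<le> k * g (?i x)"
        by (rule g(2)[OF inv_into_V[OF T x]])
      finally have "(\<Sum>y\<in>neighbours x. A x y * h y * (ln (h x) - ln (h y) + (ln (g (?i y)) - ln (g (?i x)))))
          \<le> s * h x * ln (k / s)"
        using x k g(1) inv_into_V[OF T] h_pos h(4)[OF x] by (intro weighted_log_ratio_sum_le) auto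
      then show ?thesis
        by (simp add: f_def distrib_left sum.distrib)
    qed
    have "(\<Sum>y\<in>neighbours x. ?c y * \<beta> x y) = m (\<lambda>\<tau>. \<Sum>y\<in>neighbours x. ?c y * f x y \<tau>)"
      unfolding \<beta>_def by (rule mean_sum[OF m fin[OF x] f_bounded[OF x], symmetric])
    also have "\<dots> \<le> m (\<lambda>_. s * h x * ln (k / s) - ?D)"
      by (intro mean_mono[OF m] ess_bounded_sum f_bounded x ess_bounded_const pointwise)
    also have "\<dots> = s * h x * ln (k / s) - ?D"
      by (rule mean_const[OF m])
    finally have "(\<Sum>y\<in>neighbours x. ?c y * (ln (h x) - ln (h y) + \<beta> x y)) \<le> s * h x * ln (k / s)"
      by (simp add: distrib_left sum.distrib)
    also have "\<dots> < 0"
      using k h_pos[OF x] by (intro mult_pos_neg) auto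
    finally have "h x * (\<Sum>y\<in>neighbours x. ?c y * (ln (h x) - ln (h y) + \<beta> x y)) < 0"
      using h_pos[OF x] by (rule mult_pos_neg[rotated])
    also have "h x * (\<Sum>y\<in>neighbours x. ?c y * (ln (h x) - ln (h y) + \<beta> x y)) = (\<Sum>y\<in>neighbours x. F x y)"
      unfolding sum_distrib_left F_def by (intro sum.cong refl) simp
    finally show ?thesis .
  qed

  define r where "r Y = (SOME y. y \<in> Y)" for Y :: "'a set"
  have r: "r Y \<in> Y" if "Y \<in> orbs" for Y
  proof -
    obtain y where "y \<in> V" "orb y = Y"
      using \<open>Y \<in> orbs\<close> by (auto simp: orbs_eq)
    then have "y \<in> Y"
      using orb_self by blast
    then show ?thesis
      unfolding r_def by (rule someI)
  qed
  have "(\<Sum>Y\<in>orbs. (\<Sum>z\<in>neighbours (r Y). F (r Y) z) / measure \<nu> (transporter (r Y) (r Y))) < 0"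
  proof -
    have "(\<Sum>z\<in>neighbours (r Y). F (r Y) z) / measure \<nu> (transporter (r Y) (r Y)) < 0" if "Y \<in> orbs" for Y
    proof -
      have "r Y \<in> V" using mem_orbs[OF that r[OF that]] by blast
      then show ?thesis
        using F_neg emeasure_stabilizer_pos[OF \<nu>] emeasure_stabilizer_finite[OF \<nu> lf]
        by (intro divide_neg_pos) (auto simp: measure_def enn2real_positive_iff)
    qed
    moreover have "finite orbs" "orbs \<noteq> {}"
      using qt red.nonempty by (auto simp: quasi_transitive_def)
    ultimately have "(\<Sum>Y\<in>orbs. (\<Sum>z\<in>neighbours (r Y). F (r Y) z) / measure \<nu> (transporter (r Y) (r Y))) <
        (\<Sum>Y\<in>orbs. 0)"
      by (intro sum_strict_mono)
    then show ?thesis by simp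
  qed
  moreover have "(\<Sum>Y\<in>orbs. (\<Sum>z\<in>neighbours (r Y). F (r Y) z) / measure \<nu> (transporter (r Y) (r Y))) = 0"
    by (rule antisymmetric_transport_sum_zero[OF \<nu> right lf sym qt F_inv F_anti r])
  ultimately show False by simp
qed

end

text \<open>In \<open>ennreal\<close> divergence shows up as infinity, while a divergent real sum is
  0. Summability therefore has to be extracted together with the bound, through finite partial
  sums.\<close>

lemma bounded_row_sums_real:
  assumes "weighted_graph V A" "bounded_row_sums V A"
  shows "\<exists>C. \<forall>x\<in>V. A x summable_on V \<and> (\<Sum>\<^sub>\<infinity>y\<in>V. A x y) \<le> C"
proof -
  define S where "S = (SUP x\<in>V. \<Sum>\<^sub>\<infinity>y\<in>V. ennreal (A x y))"
  have S: "S < \<infinity>"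
    using assms(2) by (simp add: S_def bounded_row_sums_def)
  have nonneg: "0 \<le> A x y" if "x \<in> V" "y \<in> V" for x y
    using assms(1) that by (simp add: weighted_graph_def)
  have partial: "sum (A x) F \<le> enn2real S" if "x \<in> V" "finite F" "F \<subseteq> V" for x F
  proof -
    have "ennreal (sum (A x) F) = (\<Sum>y\<in>F. ennreal (A x y))"
      using that nonneg by (intro sum_ennreal[symmetric]) auto
    also have "\<dots> = (\<Sum>\<^sub>\<infinity>y\<in>F. ennreal (A x y))"
      using that by simp
    also have "\<dots> \<le> (\<Sum>\<^sub>\<infinity>y\<in>V. ennreal (A x y))"
      using that by (intro infsum_mono_neutral nonneg_summable_on_complete) auto
    also have "\<dots> \<le> S"
      unfolding S_def using that by (intro SUP_upper)
    finally have "ennreal (sum (A x) F) \<le> S" .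
    then have "enn2real (ennreal (sum (A x) F)) \<le> enn2real S"
      using S by (intro enn2real_mono) auto
    then show ?thesis
      using that nonneg by (simp add: sum_nonneg subset_iff)
  qed
  have "A x summable_on V \<and> (\<Sum>\<^sub>\<infinity>y\<in>V. A x y) \<le> enn2real S" if "x \<in> V" for x
  proof
    show *: "A x summable_on V"
      using that nonneg partial[OF that] by (intro nonneg_bdd_above_summable_on) (auto intro!: bdd_aboveI2)
    show "(\<Sum>\<^sub>\<infinity>y\<in>V. A x y) \<le> enn2real S"
      by (rule infsum_le_finite_sums[OF *]) (rule partial[OF that])
  qed
  then show ?thesis by blast
qed

text \<open>Summability belongs to condition (iii) because a divergent real \<open>infsum\<close> is
  0 and would satisfy the inequality for no reason.\<close>

theorem proposition2p3:
  fixes V :: "'a set" and A :: "'a \<Rightarrow> 'a \<Rightarrow> real" and T :: "('a \<Rightarrow> 'a) set"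
  assumes "weighted_graph V A"
    and "countable V"
    and "irreducible_graph V A"
    and "bounded_row_sums V A"
    and "subgroup T (aut_group V A)"
    and "(\<exists>x\<in>V. finite (vertex_orbit V A T x)) \<or>
      (locally_finite_graph V A \<and> symmetric_graph V A \<and>
        (\<exists>x0\<in>V. \<exists>x\<in>V.
          (\<lambda>n. ln (real (card (graph_ball V A x0 n \<inter> vertex_orbit V A T x))) / real n)
            \<longlonglongrightarrow> 0)) \<or>
      (\<exists>\<psi> :: 'a \<Rightarrow> real.
        (\<forall>x\<in>V. 0 < \<psi> x) \<and>
        (\<forall>\<tau>\<in>T. \<forall>x\<in>V. \<psi> (\<tau> x) = \<psi> x) \<and>
        (\<forall>x\<in>V. (\<lambda>y. A x y * \<psi> y) summable_on V \<and>
          ereal (\<Sum>\<^sub>\<infinity>y\<in>V. A x y * \<psi> y) \<le> spectral_radius V A * ereal (\<psi> x))) \<or>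
      (symmetric_graph V A \<and> locally_finite_graph V A \<and> unweighted_graph V A \<and>
        quasi_transitive V A T \<and>
        ((INF L\<in>{L. L \<subseteq> V \<and> finite L \<and> L \<noteq> {}}.
            real (card (outer_boundary V A L)) / real (card L)) = 0 \<or>
         (amenable_group (acting_group V A T) (pointwise_topology V T) \<and>
          unimodular_group (acting_group V A T) (pointwise_topology V T))))"
  shows "spectral_radius V A = spectral_radius (orbit_space V A T) (reduced_matrix A)"
proof -
  interpret graph_action V A T
    by (intro graph_action.intro irreducible_bounded_graph.intro bounded_graph.intro
        irreducible_bounded_graph_axioms.intro graph_action_axioms.intro
        bounded_row_sums_real assms)
  show ?thesis
    using assms(6)
  proof (elim disjE conjE bexE exE)
    fix x assume "x \<in> V" "finite (orb x)"
    then show ?thesis by (rule spectral_radius_eq_if_finite_orbit)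
  next
    fix x0 x assume "locally_finite_graph V A" "symmetric_graph V A" "x0 \<in> V" "x \<in> V"
      "(\<lambda>n. ln (real (card (graph_ball V A x0 n \<inter> orb x))) / real n) \<longlonglongrightarrow> 0"
    then show ?thesis by (rule spectral_radius_eq_if_subexponential_orbit)
  next
    fix \<psi> :: "'a \<Rightarrow> real"
    assume "\<forall>x\<in>V. 0 < \<psi> x" "\<forall>\<tau>\<in>T. \<forall>x\<in>V. \<psi> (\<tau> x) = \<psi> x"
      "\<forall>x\<in>V. (\<lambda>y. A x y * \<psi> y) summable_on V \<and>
          ereal (\<Sum>\<^sub>\<infinity>y\<in>V. A x y * \<psi> y) \<le> spectral_radius V A * ereal (\<psi> x)"
    then show ?thesis by (intro spectral_radius_eq_if_superharmonic[of \<psi>]) blast+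
  next
    assume "symmetric_graph V A" "locally_finite_graph V A" "quasi_transitive V A T"
      "(INF L\<in>{L. L \<subseteq> V \<and> finite L \<and> L \<noteq> {}}.
            real (card (outer_boundary V A L)) / real (card L)) = 0"
    then show ?thesis by (intro spectral_radius_eq_if_not_isoperimetric)
  next
    assume "symmetric_graph V A" "locally_finite_graph V A" "quasi_transitive V A T"
      "amenable_group (acting_group V A T) X" "unimodular_group (acting_group V A T) X"
    then show ?thesis by (intro spectral_radius_eq_if_amenable_unimodular)
  qed
qed

end
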